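(* Let $\mathscr{U}=(U,\mathcal{A},\lambda)$ be a linear reflexive object in a Cartesian closed differential category. Let $S,T$ be differential $\lambda$-terms, $\vec x=x_1,\dots,x_n$ a sequence of distinct variables and $y$ a variable not occurring in $\vec x$, such that $\vec x,y$ is adequate for $S$ and $\vec x$ is adequate for $T$. Then $[\![\frac{\partial S}{\partial y}\cdot T]\!]_{\vec x,y}=[\![S]\!]_{\vec x,y}\star[\![T]\!]_{\vec x}$.
   Context: Cartesian closed differential category: a category with commutative-monoid homsets $(+,0)$ satisfying $(g+h)\circ f=g\circ f+h\circ f$, $0\circ f=0$, with finite products whose projections are additive ($f\circ(g+h)=f\circ g+f\circ h$, $f\circ0=0$) and pairings of additive maps additive, with an operator $D$ sending $f:A\to B$ to $D(f):A\times A\to B$ satisfying (D1) $D(f+g)=D(f)+D(g)$, $D(0)=0$; (D2) $D(f)\circ\langle h+k,v\rangle=D(f)\circ\langle h,v\rangle+D(f)\circ\langle k,v\rangle$, $D(f)\circ\langle0,v\rangle=0$; (D3) $D(\mathrm{Id})=\pi_1$, $D(\pi_1)=\pi_1\circ\pi_1$, $D(\pi_2)=\pi_2\circ\pi_1$; (D4) $D\langle f,g\rangle=\langle D(f),D(g)\rangle$; (D5) $D(f\circ g)=D(f)\circ\langle D(g),g\circ\pi_2\rangle$; (D6) $D(D(f))\circ\langle\langle g,0\rangle,\langle h,k\rangle\rangle=D(f)\circ\langle g,k\rangle$; (D7) $D(D(f))\circ\langle\langle0,h\rangle,\langle g,k\rangle\rangle=D(D(f))\circ\langle\langle0,g\rangle,\langle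 h,k\rangle\rangle$; which is Cartesian closed (exponential $[A\Rightarrow B]$, $\mathrm{ev}$, currying $\Lambda$) with $\Lambda(f+g)=\Lambda(f)+\Lambda(g)$, $\Lambda(0)=0$ and $D(\Lambda(f))=\Lambda(D(f)\circ\langle\pi_1\times0_A,\pi_2\times\mathrm{Id}_A\rangle)$ for $f:C\times A\to B$. $\Lambda^-(h)=\mathrm{ev}\circ(h\times\mathrm{Id})$. $f$ is linear if $D(f)=f\circ\pi_1$. For $f:C\times A\to B$, $g:C\to A$: $f\star g=D(f)\circ\langle\langle0_C,g\circ\pi_1\rangle,\mathrm{Id}_{C\times A}\rangle$. A linear reflexive object is $(U,\mathcal{A},\lambda)$ with $\mathcal{A}:U\to[U\Rightarrow U]$, $\lambda:[U\Rightarrow U]\to U$, $\mathcal{A}\circ\lambda=\mathrm{Id}$, both linear. Differential $\lambda$-terms $S,T::=0\mid s\mid s+T$, simple terms $s,t::=x\mid\lambda x.s\mid sT\mid\mathsf{D}s\cdot t$, modulo $\alpha$-conversion, AC of $+$ with unit $0$, and permutation of the arguments of $\mathsf{D}^ns\cdot(t_1,\dots,t_n)$ ($\mathsf{D}^1s\cdot t=\mathsf{D}s\cdot t$, $\mathsf{D}^{n+1}s\cdot(t,t_1,\dots,t_n)=\mathsf{D}^n(\mathsf{D}s\cdot t)\cdot(t_1,\dots,t_n)$); abbreviations $\lambda x.\sum s_i=\sum\lambda x.s_i$, $(\sum s_i)T=\sum s_iT$, $\mathsf{D}(\sum s_i)\cdot(\sum t_j)=\sum\mathsf{D}s_i\cdot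 t_j$. Differential substitution: $\frac{\partial z}{\partial y}\cdot T=T$ if $z=y$, else $0$; $\frac{\partial(sV)}{\partial y}\cdot T=(\frac{\partial s}{\partial y}\cdot T)V+(\mathsf{D}s\cdot(\frac{\partial V}{\partial y}\cdot T))V$; $\frac{\partial(\lambda z.s)}{\partial y}\cdot T=\lambda z.\frac{\partial s}{\partial y}\cdot T$ ($z\neq y$, $z\notin\mathrm{FV}(T)$); $\frac{\partial(\mathsf{D}^ns\cdot(u_1..u_n))}{\partial y}\cdot T=\mathsf{D}^n(\frac{\partial s}{\partial y}\cdot T)\cdot(u_1..u_n)+\sum_i\mathsf{D}^ns\cdot(u_1,..,\frac{\partial u_i}{\partial y}\cdot T,..,u_n)$; $\frac{\partial0}{\partial y}\cdot T=0$; linear on sums. Interpretation: for distinct variables $\vec x=x_1,\dots,x_n$, $U^{\vec x}=U^{x_1..x_{n-1}}\times U$ (empty: terminal), $\pi^{\vec x}_n=\pi_2$, $\pi^{\vec x}_i=\pi^{x_1..x_{n-1}}_i\circ\pi_1$; $\vec x$ adequate for $S$ if it contains all free variables of $S$. $[\![x_i]\!]_{\vec x}=\pi_i^{\vec x}$; $[\![sT]\!]=\mathrm{ev}\circ\langle\mathcal{A}\circ[\![s]\!],[\![T]\!]\rangle$; $[\![\lambda z.s]\!]_{\vec x}=\lambda\circ\Lambda([\![s]\!]_{\vec x,z})$; $[\![\mathsf{D}^1s\cdot t]\!]=\lambda\circ\Lambda(\Lambda^-(\mathcal{A}\circ[\![s]\!])\star[\![t]\!])$; $[\![\mathsf{D}^{n+1}s\cdot(t_1..t_{n+1})]\!]=\lambda\circ\Lambda(\Lambda^-(\mathcal{A}\circ[\![\mathsf{D}^ns\cdot(t_1..t_n)]\!])\star[\![t_{n+1}]\!])$;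 $[\![0]\!]=0$; $[\![s+S]\!]=[\![s]\!]+[\![S]\!]$. *)

theory Defs
  imports "HOL-Library.Multiset" "HOL-Combinatorics.Transposition"
begin

type_synonym var = nat

text \<open>Raw simple terms. A raw differential term is the list of the summands of
  \<open>s\<^sub>1 + \<dots> + s\<^sub>n\<close>, with \<open>[]\<close> for \<open>0\<close> and \<open>s # S\<close> for \<open>s + S\<close>; a simple term
  \<open>s\<close> is the sum \<open>[s]\<close>. \<open>RDif s t\<close> is \<open>D s \<cdot> t\<close>, and \<open>D\<^sup>n s \<cdot> (t\<^sub>1, \<dots>, t\<^sub>n)\<close>
  is \<open>foldl RDif s [t\<^sub>1, \<dots>, t\<^sub>n]\<close>.\<close>

datatype simple =
    RVar var
  | RLam var simple
  | RApp simple "simple list"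
  | RDif simple simple

type_synonym raw = "simple list"

fun names :: "simple \<Rightarrow> var set" where
  "names (RVar x) = {x}"
| "names (RLam x s) = insert x (names s)"
| "names (RApp s T) = names s \<union> (\<Union>t\<in>set T. names t)"
| "names (RDif s t) = names s \<union> names t"

fun fv :: "simple \<Rightarrow> var set" where
  "fv (RVar x) = {x}"
| "fv (RLam x s) = fv s - {x}"
| "fv (RApp s T) = fv s \<union> (\<Union>t\<in>set T. fv t)"
| "fv (RDif s t) = fv s \<union> fv t"

definition fvs :: "raw \<Rightarrow> var set" where
  "fvs T = (\<Union>t\<in>set T. fv t)"

text \<open>\<open>ren\<close> acts on all occurrences of a name, binding ones included.\<close>

fun ren :: "(var \<Rightarrow> var) \<Rightarrow> simple \<Rightarrow> simple" where
  "ren f (RVar x) = RVar (f x)"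
| "ren f (RLam x s) = RLam (f x) (ren f s)"
| "ren f (RApp s T) = RApp (ren f s) (map (ren f) T)"
| "ren f (RDif s t) = RDif (ren f s) (ren f t)"

text \<open>The rule \<open>s_alpha\<close> is alpha-conversion to a name that does not occur in the body;
  \<open>s_perm\<close> exchanges adjacent arguments of an iterated derivative, which generates all
  permutations; \<open>l_comm\<close> is commutativity of the sum (associativity and the unit law are built
  into lists).\<close>

inductive seqv :: "simple \<Rightarrow> simple \<Rightarrow> bool" (infix "\<simeq>" 50)
  and leqv :: "raw \<Rightarrow> raw \<Rightarrow> bool" (infix "\<approx>" 50)
where
  s_refl: "s \<simeq> s"
| s_sym: "s \<simeq> t \<Longrightarrow> t \<simeq> s"
| s_trans: "s \<simeq> t \<Longrightarrow> t \<simeq> u \<Longrightarrow> s \<simeq> u"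
| s_lam: "s \<simeq> s' \<Longrightarrow> RLam x s \<simeq> RLam x s'"
| s_app: "s \<simeq> s' \<Longrightarrow> T \<approx> T' \<Longrightarrow> RApp s T \<simeq> RApp s' T'"
| s_dif: "s \<simeq> s' \<Longrightarrow> t \<simeq> t' \<Longrightarrow> RDif s t \<simeq> RDif s' t'"
| s_alpha: "y \<notin> names s \<Longrightarrow> RLam x s \<simeq> RLam y (ren (id(x := y)) s)"
| s_perm: "RDif (RDif s t) u \<simeq> RDif (RDif s u) t"
| l_refl: "S \<approx> S"
| l_sym: "S \<approx> T \<Longrightarrow> T \<approx> S"
| l_trans: "S \<approx> T \<Longrightarrow> T \<approx> V \<Longrightarrow> S \<approx> V"
| l_cons: "s \<simeq> s' \<Longrightarrow> S \<approx> S' \<Longrightarrow> s # S \<approx> s' # S'"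
| l_comm: "s # t # S \<approx> t # s # S"

declare s_trans [trans] l_trans [trans]

quotient_type dterm = raw / leqv
  by (intro equivpI reflpI sympI transpI) (blast intro: l_refl l_sym l_trans)+

text \<open>The extensions of the constructors to sums by linearity.\<close>

definition sum_lam :: "var \<Rightarrow> raw \<Rightarrow> raw" where
  "sum_lam x S = map (RLam x) S"

definition sum_app :: "raw \<Rightarrow> raw \<Rightarrow> raw" where
  "sum_app S T = map (\<lambda>s. RApp s T) S"

definition sum_dif :: "raw \<Rightarrow> raw \<Rightarrow> raw" where
  "sum_dif S T = concat (map (\<lambda>s. map (RDif s) T) S)"

definition fresh :: "var set \<Rightarrow> var" where
  "fresh X = (LEAST z. z \<notin> X)"

lemma size_ren [simp]: "size (ren f s) = size s"
  by (induction s) (auto simp: size_list_conv_sum_list comp_def cong: map_cong)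

text \<open>\<open>dsub y T s\<close> is the differential substitution \<open>\<partial>s/\<partial>y \<cdot> T\<close>. On an abstraction the bound
  variable is always renamed first; \<open>dsub_RLam\<close> below is the usual clause, without renaming. The
  clause for \<open>RDif\<close> is the unary case of the one for iterated derivatives, which is derived
  from it as \<open>dsub_nary\<close>.\<close>

function dsub :: "var \<Rightarrow> raw \<Rightarrow> simple \<Rightarrow> raw" where
  "dsub y T (RVar z) = (if z = y then T else [])"
| "dsub y T (RApp s V) =
     sum_app (dsub y T s) V @ sum_app (sum_dif [s] (concat (map (dsub y T) V))) V"
| "dsub y T (RLam z s) =
     (let w = fresh ({y} \<union> fvs T \<union> names s) in sum_lam w (dsub y T (ren (id(z := w)) s)))"
| "dsub y T (RDif s u) = sum_dif (dsub y T s) [u] @ sum_dif [s] (dsub y T u)"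
  by pat_completeness auto
termination
  by (relation "measure (\<lambda>(y, T, s). size s)") (auto simp: less_Suc_eq_le intro: trans_le_add1 size_list_estimation')

definition dsubs :: "var \<Rightarrow> raw \<Rightarrow> raw \<Rightarrow> raw" where
  "dsubs y T S = concat (map (dsub y T) S)"

lemma fresh: "finite X \<Longrightarrow> fresh X \<notin> X"
  unfolding fresh_def by (rule LeastI_ex) (rule ex_new_if_finite[OF infinite_UNIV_nat])

lemma finite_names [simp]: "finite (names s)" by (induction s) auto
lemma fv_subset_names: "fv s \<subseteq> names s" by (induction s) auto
lemma finite_fvs [simp]: "finite (fvs T)"
  unfolding fvs_def using finite_subset[OF fv_subset_names finite_names] by auto

lemma fvs_simps [simp]: "fvs [] = {}" "fvs (s # S) = fv s \<union> fvs S" "fvs (S @ T) = fvs S \<union> fvs T"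
  by (auto simp: fvs_def)

lemma names_ren: "names (ren f s) = f ` names s"
  by (induction s) auto

lemma fv_ren: "inj_on f (names s) \<Longrightarrow> fv (ren f s) = f ` fv s"
proof (induction s)
  case (RLam x s)
  then have "inj_on f (names s)" by (auto intro: inj_on_subset)
  with RLam.IH have "fv (ren f s) = f ` fv s" by simp
  moreover have "f ` (fv s - {x}) = f ` fv s - f ` {x}"
    using RLam.prems fv_subset_names[of s]
    by (intro inj_on_image_set_diff[of f "names (RLam x s)"]) auto
  ultimately show ?case by simp
next
  case (RApp s T)
  have "inj_on f (names t)" if "t \<in> set T" for t
    using RApp.prems that by (auto intro: inj_on_subset)
  then have "fv (ren f t) = f ` fv t" if "t \<in> set T" for t using RApp.IH(2) that by blast
  moreover have "fv (ren f s) = f ` fv s"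
    using RApp.prems by (intro RApp.IH(1)) (auto intro: inj_on_subset)
  ultimately show ?case by auto
next
  case (RDif s t)
  have "inj_on f (names s)" "inj_on f (names t)" 
    using RDif.prems by (auto intro: inj_on_subset)
  then show ?case using RDif.IH by auto
qed auto

lemma ren_cong: "(\<And>x. x \<in> names s \<Longrightarrow> f x = g x) \<Longrightarrow> ren f s = ren g s"
  by (induction s) auto

lemma ren_ren: "ren f (ren g s) = ren (f \<circ> g) s"
  by (induction s) auto

lemma ren_upd: "y \<notin> names s \<Longrightarrow> ren (id(x := y)) s = ren (transpose x y) s"
  by (rule ren_cong) (auto simp: transpose_def)

lemma inj_on_upd: "y \<notin> names s \<Longrightarrow> inj_on (id(x := y)) (names s)"
  by (auto simp: inj_on_def)

lemma fv_seqv: "s \<simeq> t \<Longrightarrow> fv s = fv t" and fvs_leqv: "S \<approx> T \<Longrightarrow> fvs S = fvs T"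
proof (induction rule: seqv_leqv.inducts)
  case (s_alpha y s x)
  then show ?case using fv_subset_names[of s]
    by (auto simp: fv_ren[OF inj_on_upd] split: if_splits)
qed (auto simp: fvs_def)

lift_definition FV :: "dterm \<Rightarrow> var set" is fvs
  by (rule fvs_leqv)

lemma l_append: "S \<approx> S' \<Longrightarrow> T \<approx> T' \<Longrightarrow> S @ T \<approx> S' @ T'"
proof -
  assume T: "T \<approx> T'"
  have "S @ T \<approx> S @ T'" for S
    by (induction S) (auto intro: T l_cons s_refl)
  moreover assume "S \<approx> S'"
  then have "S @ T' \<approx> S' @ T'"
  proof (induction rule: seqv_leqv.inducts(2)[where ?P1.0 = "\<lambda>_ _. True"])
  qed (auto intro: l_refl l_sym l_trans l_cons l_comm)
  ultimately show ?thesis by (blast intro: l_trans)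
qed

lemma l_move: "s # S @ T \<approx> S @ s # T"
proof (induction S)
  case (Cons t S)
  have "s # t # S @ T \<approx> t # s # S @ T" by (rule l_comm)
  also have "t # s # S @ T \<approx> t # S @ s # T" using Cons by (auto intro: l_cons s_refl)
  finally show ?case by simp
qed (simp add: l_refl)

lemma l_mset: "mset S = mset T \<Longrightarrow> S \<approx> T"
proof (induction S arbitrary: T)
  case Nil then show ?case by (simp add: l_refl)
next
  case (Cons s S)
  then have "s \<in> set T" by (metis list.set_intros(1) mset_eq_setD)
  then obtain A B where T: "T = A @ s # B" by (auto simp: in_set_conv_decomp)
  with Cons have "S \<approx> A @ B" by simp
  then have "s # S \<approx> s # A @ B" by (intro l_cons s_refl)
  with T show ?case using l_move l_trans by blast
qed

lemma l_concat:
  assumes "S \<approx> S'" and "\<And>s s'. s \<simeq> s' \<Longrightarrow> F s \<approx> F s'"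
  shows "concat (map F S) \<approx> concat (map F S')"
  using assms(1)
proof (induction rule: seqv_leqv.inducts(2)[where ?P1.0 = "\<lambda>_ _. True"])
  case (l_cons s s' S S')
  then show ?case using assms(2) by (auto intro: l_append)
next
  case (l_comm s t S)
  show ?case by (auto intro: l_mset)
qed (auto intro: l_refl l_sym l_trans)

lemma l_single: "s \<simeq> t \<Longrightarrow> [s] \<approx> [t]" by (intro l_cons l_refl)

lemma l_map:
  assumes "S \<approx> S'" and "\<And>s s'. s \<simeq> s' \<Longrightarrow> f s \<simeq> f s'"
  shows "map f S \<approx> map f S'"
  using l_concat[of S S' "\<lambda>s. [f s]"] assms by (auto simp: l_single)

lemma l_concat_fun:
  assumes "\<And>s. s \<in> set S \<Longrightarrow> F s \<approx> G s"
  shows "concat (map F S) \<approx> concat (map G S)"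
  using assms by (induction S) (auto intro: l_append l_refl)

lemma l_map_fun:
  assumes "\<And>s. s \<in> set S \<Longrightarrow> f s \<simeq> g s"
  shows "map f S \<approx> map g S"
  using assms by (induction S) (auto intro: l_cons l_refl)

lemma sum_lam_cong: "S \<approx> S' \<Longrightarrow> sum_lam x S \<approx> sum_lam x S'"
  unfolding sum_lam_def by (rule l_map) (auto intro: s_lam)

lemma sum_app_cong: "S \<approx> S' \<Longrightarrow> T \<approx> T' \<Longrightarrow> sum_app S T \<approx> sum_app S' T'"
  unfolding sum_app_def
  by (rule l_trans[OF l_map[of S S'] l_map_fun]) (auto intro: s_app l_refl s_refl)

lemma sum_dif_cong: "S \<approx> S' \<Longrightarrow> T \<approx> T' \<Longrightarrow> sum_dif S T \<approx> sum_dif S' T'"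
  unfolding sum_dif_def
  by (rule l_trans[OF l_concat[of S S'] l_concat_fun])
    (auto intro: l_map_fun l_map s_dif l_refl s_refl)

lemma ren_eqv:
  assumes "inj f"
  shows "s \<simeq> t \<Longrightarrow> ren f s \<simeq> ren f t" and "S \<approx> T \<Longrightarrow> map (ren f) S \<approx> map (ren f) T"
proof (induction rule: seqv_leqv.inducts)
  case (s_alpha y s x)
  have "ren f (ren (id(x := y)) s) = ren (id(f x := f y)) (ren f s)"
    unfolding ren_ren using s_alpha assms by (intro ren_cong) (auto dest: injD)
  moreover have "f y \<notin> names (ren f s)" using s_alpha assms by (auto simp: names_ren dest: injD)
  ultimately show ?case by (auto intro: seqv_leqv.s_alpha)
qed (auto intro: seqv_leqv.intros)

lemma s_alpha': "w \<notin> names s \<Longrightarrow> RLam z s \<simeq> RLam w (ren (transpose z w) s)"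
  using s_alpha[of w s z] by (simp add: ren_upd)

lemma inj_transpose: "inj (transpose a b)"
  by simp

lemma ren_agree:
  "inj f \<Longrightarrow> inj g \<Longrightarrow> (\<And>x. x \<in> fv s \<Longrightarrow> f x = g x) \<Longrightarrow> ren f s \<simeq> ren g s"
proof (induction s arbitrary: f g)
  case (RVar x)
  then show ?case by (simp add: s_refl)
next
  case (RLam x s)
  define w where "w = fresh (names (ren f s) \<union> names (ren g s))"
  have w: "w \<notin> names (ren f s)" "w \<notin> names (ren g s)"
    using fresh[of "names (ren f s) \<union> names (ren g s)"] unfolding w_def by auto
  have "ren (transpose (f x) w \<circ> f) s \<simeq> ren (transpose (g x) w \<circ> g) s"
  proof (rule RLam.IH)
    show "inj (transpose (f x) w \<circ> f)" "inj (transpose (g x) w \<circ> g)"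
      using RLam.prems(1,2) by (auto intro: inj_compose)
    fix v assume v: "v \<in> fv s"
    have "v \<in> names s" using v fv_subset_names by auto
    then have "f v \<noteq> w" "g v \<noteq> w" using w by (auto simp: names_ren)
    moreover have "f v = g v \<and> f v \<noteq> f x \<and> g v \<noteq> g x" if "v \<noteq> x"
      using RLam.prems(3)[of v] v that inj_eq[OF RLam.prems(1)] inj_eq[OF RLam.prems(2)] by auto
    ultimately show "(transpose (f x) w \<circ> f) v = (transpose (g x) w \<circ> g) v"
      by (cases "v = x") (auto simp: transpose_def)
  qed
  then have "RLam w (ren (transpose (f x) w) (ren f s)) \<simeq> RLam w (ren (transpose (g x) w) (ren g s))"
    unfolding ren_ren by (rule s_lam)
  then show ?case using s_alpha'[OF w(1), of "f x"] s_alpha'[OF w(2), of "g x"]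
    by (auto intro: s_trans s_sym)
next
  case (RApp s T)
  have "ren f s \<simeq> ren g s" using RApp.prems by (intro RApp.IH(1)) auto
  moreover have "map (ren f) T \<approx> map (ren g) T" using RApp.prems 
    by (intro l_map_fun RApp.IH(2)) auto
  ultimately show ?case by (auto intro: s_app)
next
  case (RDif s t)
  then show ?case by (auto intro: s_dif)
qed

lemma ren_id [simp]: "ren id s = s" "ren (\<lambda>x. x) s = s"
  by (induction s) (auto simp: map_idI)

lemma alpha_fv:
  assumes "w \<notin> fv s \<or> w = z"
  shows "RLam z s \<simeq> RLam w (ren (transpose z w) s)"
proof -
  define v where "v = fresh (names s \<union> names (ren (transpose z w) s))"
  have v: "v \<notin> names s" "v \<notin> names (ren (transpose z w) s)"
    using fresh[of "names s \<union> names (ren (transpose z w) s)"] unfolding v_def by auto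
  have "ren (transpose z v) s \<simeq> ren (transpose w v \<circ> transpose z w) s"
  proof (rule ren_agree)
    show "inj (transpose w v \<circ> transpose z w)" by (auto intro: inj_compose)
    fix u assume u: "u \<in> fv s"
    then have "u \<noteq> v" using v(1) fv_subset_names by auto
    with u assms show "transpose z v u = (transpose w v \<circ> transpose z w) u"
      by (auto simp: transpose_def)
  qed auto
  then have "RLam v (ren (transpose z v) s) \<simeq> RLam v (ren (transpose w v) (ren (transpose z w) s))"
    unfolding ren_ren by (rule s_lam)
  then show ?thesis using s_alpha'[OF v(1), of z] s_alpha'[OF v(2), of w]
    by (auto intro: s_trans s_sym)
qed

lemma dsub_cong_left: "T \<approx> T' \<Longrightarrow> dsub y T s \<approx> dsub y T' s"
proof (induction y T s rule: dsub.induct)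
  case (1 y T z) then show ?case by (auto intro: l_refl)
next
  case (2 y T s V)
  then show ?case
    by (auto intro!: l_append sum_app_cong sum_dif_cong l_concat_fun l_refl)
next
  case (3 y T z s)
  then show ?case using fvs_leqv[OF 3(2)] by (auto simp: Let_def intro: sum_lam_cong)
next
  case (4 y T s u)
  then show ?case by (auto intro!: l_append sum_dif_cong l_refl)
qed

lemma map_ren_sum:
  "map (ren f) (sum_lam x S) = sum_lam (f x) (map (ren f) S)"
  "map (ren f) (sum_app S T) = sum_app (map (ren f) S) (map (ren f) T)"
  "map (ren f) (sum_dif S T) = sum_dif (map (ren f) S) (map (ren f) T)"
  by (auto simp: sum_lam_def sum_app_def sum_dif_def map_concat comp_def)

lemma fvs_sum:
  "fvs (sum_lam x S) = fvs S - {x}"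
  "fvs (sum_app S T) \<subseteq> fvs S \<union> fvs T"
  "fvs (sum_dif S T) \<subseteq> fvs S \<union> fvs T"
  by (auto simp: sum_lam_def sum_app_def sum_dif_def fvs_def)

lemma fvs_dsub: "fvs (dsub y T s) \<subseteq> fv s \<union> fvs T"
proof (induction y T s rule: dsub.induct)
  case (2 y T s V)
  have "fvs (concat (map (dsub y T) V)) \<subseteq> (\<Union>v\<in>set V. fv v) \<union> fvs T"
    using 2(2) by (fastforce simp: fvs_def)
  then show ?case
    using 2(1) fvs_sum(2)[of "dsub y T s" V]
      fvs_sum(2)[of "sum_dif [s] (concat (map (dsub y T) V))" V]
      fvs_sum(3)[of "[s]" "concat (map (dsub y T) V)"]
    by (auto simp: fvs_def[of V])
next
  case (3 y T z s)
  define w where "w = fresh ({y} \<union> fvs T \<union> names s)"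
  have w: "w \<notin> names s" using fresh[of "{y} \<union> fvs T \<union> names s"] unfolding w_def by auto
  have "fvs (dsub y T (ren (id(z := w)) s)) \<subseteq> fv (ren (id(z := w)) s) \<union> fvs T"
    using 3[OF w_def] .
  then have "fvs (sum_lam w (dsub y T (ren (id(z := w)) s))) \<subseteq> fv (RLam z s) \<union> fvs T"
    using fv_subset_names[of s] by (auto simp: fvs_sum fv_ren[OF inj_on_upd[OF w]] split: if_splits)
  then show ?case by (simp add: Let_def w_def)
next
  case (4 y T s u)
  then show ?case using fvs_sum(3)[of "dsub y T s" "[u]"] fvs_sum(3)[of "[s]" "dsub y T u"] by auto
qed auto

lemma leqv_ren_fresh:
  "inj f \<Longrightarrow> (\<And>x. x \<in> fvs T \<Longrightarrow> f x = x) \<Longrightarrow> map (ren f) T \<approx> T"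
proof -
  assume "inj f" "\<And>x. x \<in> fvs T \<Longrightarrow> f x = x"
  then have "map (ren f) T \<approx> map (ren id) T"
    by (intro l_map_fun ren_agree) (auto simp: fvs_def)
  then show ?thesis by (simp add: map_idI)
qed

lemma map_lam_alpha:
  assumes "w \<notin> fvs R \<or> w = z"
  shows "sum_lam z R \<approx> sum_lam w (map (ren (transpose z w)) R)"
  unfolding sum_lam_def map_map comp_def using assms
  by (intro l_map_fun alpha_fv) (auto simp: fvs_def)

lemma fvs_map_ren: "inj f \<Longrightarrow> fvs (map (ren f) T) = f ` fvs T"
  by (auto simp: fvs_def fv_ren inj_on_subset[OF _ subset_UNIV])

lemma dsub_equivariant:
  "inj f \<Longrightarrow> map (ren f) (dsub y T s) \<approx> dsub (f y) (map (ren f) T) (ren f s)"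
proof (induction "size s" arbitrary: s y T f rule: less_induct)
  case less
  show ?case
  proof (cases s)
    case (RVar x)
    then show ?thesis using less.prems by (auto intro: l_refl dest: injD)
  next
    case (RApp t V)
    have "map (ren f) (dsub y T t) \<approx> dsub (f y) (map (ren f) T) (ren f t)"
      using RApp less by simp
    moreover have "map (ren f) (dsub y T v) \<approx> dsub (f y) (map (ren f) T) (ren f v)" 
      if "v \<in> set V" for v
      using RApp less that by (simp add: less_Suc_eq_le size_list_estimation' trans_le_add1)
    ultimately show ?thesis using RApp
      by (auto simp: map_ren_sum map_concat comp_def
          intro!: l_append sum_app_cong sum_dif_cong l_concat_fun l_refl)
  next
    case (RDif t u)
    have "map (ren f) (dsub y T t) \<approx> dsub (f y) (map (ren f) T) (ren f t)"
      "map (ren f) (dsub y T u) \<approx> dsub (f y) (map (ren f) T) (ren f u)"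
      using RDif less by simp_all
    then show ?thesis using RDif
      by (auto simp: map_ren_sum intro!: l_append sum_dif_cong l_refl)
  next
    case (RLam z t)
    have IH: "map (ren g) (dsub y' T' t') \<approx> dsub (g y') (map (ren g) T') (ren g t')"
      if "inj g" "size t' = size t" for g y' T' t'
      using less.hyps[OF _ that(1), of t' y' T'] RLam that(2) by simp
    let ?T = "map (ren f) T" and ?t = "ren f t"
    define w where "w = fresh ({y} \<union> fvs T \<union> names t)"
    define w' where "w' = fresh ({f y} \<union> fvs ?T \<union> names ?t)"
    have w: "w \<noteq> y" "w \<notin> fvs T" "w \<notin> names t"
      using fresh[of "{y} \<union> fvs T \<union> names t"] unfolding w_def by auto
    have w': "w' \<noteq> f y" "w' \<notin> fvs ?T" "w' \<notin> names ?t"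
      using fresh[of "{f y} \<union> fvs ?T \<union> names ?t"] unfolding w'_def by auto
    let ?g = "transpose (f w) w'"
    have fw: "f w \<noteq> f y" "f w \<notin> fvs ?T" "f w \<notin> names ?t"
      using w less.prems by (auto simp: fvs_map_ren names_ren dest: injD)
    let ?R = "dsub (f y) ?T (ren f (ren (id(z := w)) t))"
    have "map (ren f) (dsub y T s) = sum_lam (f w) (map (ren f) (dsub y T (ren (id(z := w)) t)))"
      using RLam by (simp add: Let_def w_def map_ren_sum)
    also have "\<dots> \<approx> sum_lam (f w) ?R"
      by (rule sum_lam_cong) (rule IH[OF less.prems], simp)
    also have "\<dots> \<approx> sum_lam w' (map (ren ?g) ?R)"
    proof (rule map_lam_alpha)
      have "w' \<notin> fvs ?R \<or> w' = f w"
      proof (rule disjCI)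
        assume "w' \<noteq> f w"
        have "fv (ren f (ren (id(z := w)) t)) \<subseteq> insert (f w) (names ?t)"
          using fv_subset_names[of "ren f (ren (id(z := w)) t)"] by (auto simp: names_ren split: if_splits)
        then show "w' \<notin> fvs ?R" using fvs_dsub[of "f y" ?T "ren f (ren (id(z := w)) t)"] w' \<open>w' \<noteq> f w\<close> by auto
      qed
      then show "w' \<notin> fvs ?R \<or> w' = f w" .
    qed
    also have "\<dots> \<approx> sum_lam w' (dsub (?g (f y)) (map (ren ?g) ?T) (ren ?g (ren f (ren (id(z := w)) t))))"
      by (rule sum_lam_cong, rule IH) auto
    also have "?g (f y) = f y" using w' fw by (auto simp: transpose_def)
    also have "ren ?g (ren f (ren (id(z := w)) t)) = ren (id(f z := w')) ?t"
      unfolding ren_ren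
    proof (rule ren_cong)
      fix x assume "x \<in> names t"
      then have "x \<noteq> w" "f x \<noteq> w'" "f x \<noteq> f w" using w w' fw
        by (auto simp: names_ren) (metis imageI)
      then show "(?g \<circ> (f \<circ> id(z := w))) x = (id(f z := w') \<circ> f) x"
        using less.prems by (auto simp: transpose_def dest: injD)
    qed
    also have "sum_lam w' (dsub (f y) (map (ren ?g) ?T) (ren (id(f z := w')) ?t))
        \<approx> sum_lam w' (dsub (f y) ?T (ren (id(f z := w')) ?t))"
      using w' fw by (intro sum_lam_cong dsub_cong_left leqv_ren_fresh) (auto simp: transpose_def)
    also have "\<dots> = dsub (f y) ?T (ren f s)"
      using RLam by (simp add: Let_def w'_def)
    finally show ?thesis .
  qed
qed

lemma dsub_RLam:
  assumes "z \<noteq> y" "z \<notin> fvs T"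
  shows "dsub y T (RLam z s) \<approx> sum_lam z (dsub y T s)"
proof -
  define w where "w = fresh ({y} \<union> fvs T \<union> names s)"
  have w: "w \<noteq> y" "w \<notin> fvs T" "w \<notin> names s"
    using fresh[of "{y} \<union> fvs T \<union> names s"] unfolding w_def by auto
  let ?g = "transpose z w"
  have "sum_lam z (dsub y T s) \<approx> sum_lam w (map (ren ?g) (dsub y T s))"
    using w fvs_dsub[of y T s] fv_subset_names[of s] by (intro map_lam_alpha) auto
  also have "\<dots> \<approx> sum_lam w (dsub (?g y) (map (ren ?g) T) (ren ?g s))"
    by (intro sum_lam_cong dsub_equivariant) auto
  also have "?g y = y" using w assms by (auto simp: transpose_def)
  also have "sum_lam w (dsub y (map (ren ?g) T) (ren ?g s)) \<approx> sum_lam w (dsub y T (ren ?g s))"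
    using w assms by (intro sum_lam_cong dsub_cong_left leqv_ren_fresh) (auto simp: transpose_def)
  also have "\<dots> = dsub y T (RLam z s)"
    using w by (simp add: Let_def w_def ren_upd)
  finally show ?thesis by (rule l_sym)
qed

lemma dsub_RLam_rename:
  assumes "w \<notin> {y} \<union> fvs T \<union> names s"
  shows "dsub y T (RLam z s) \<approx> sum_lam w (dsub y T (ren (transpose z w) s))"
proof -
  define v where "v = fresh ({y} \<union> fvs T \<union> names s)"
  have v: "v \<noteq> y" "v \<notin> fvs T" "v \<notin> names s"
    using fresh[of "{y} \<union> fvs T \<union> names s"] unfolding v_def by auto
  have eq: "ren (id(w := v)) (ren (transpose z w) s) = ren (id(z := v)) s"
    unfolding ren_ren using assms by (intro ren_cong) (auto simp: transpose_def)
  let ?s = "ren (transpose z w) s" and ?g = "transpose w v"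
  have "sum_lam w (dsub y T ?s) \<approx> sum_lam v (map (ren ?g) (dsub y T ?s))"
  proof (rule map_lam_alpha)
    have "v \<notin> fv ?s \<or> v = w" using v(3) fv_subset_names[of s] assms
      by (auto simp: fv_ren inj_on_subset[OF inj_transpose subset_UNIV] transpose_def split: if_splits)
    then show "v \<notin> fvs (dsub y T ?s) \<or> v = w" using v fvs_dsub[of y T ?s] by auto
  qed
  also have "\<dots> \<approx> sum_lam v (dsub (?g y) (map (ren ?g) T) (ren ?g ?s))"
    by (intro sum_lam_cong dsub_equivariant) auto
  also have "?g y = y" using v assms by (auto simp: transpose_def)
  also have "ren ?g ?s = ren (id(z := v)) s"
    unfolding ren_ren using assms v by (intro ren_cong) (auto simp: transpose_def)
  also have "sum_lam v (dsub y (map (ren ?g) T) (ren (id(z := v)) s)) \<approx> sum_lam v (dsub y T (ren (id(z := v)) s))"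
    using v assms by (intro sum_lam_cong dsub_cong_left leqv_ren_fresh) (auto simp: transpose_def)
  also have "\<dots> = dsub y T (RLam z s)" by (simp add: Let_def v_def)
  finally show ?thesis by (rule l_sym)
qed

lemma dsub_cong_right:
  "s \<simeq> s' \<Longrightarrow> \<forall>y T. dsub y T s \<approx> dsub y T s'" and dsubs_cong_right:
  "S \<approx> S' \<Longrightarrow> \<forall>y T. dsubs y T S \<approx> dsubs y T S'"
proof (induction rule: seqv_leqv.inducts)
  case (s_lam s s' x)
  show ?case
  proof (intro allI)
    fix y T
    define w where "w = fresh ({y} \<union> fvs T \<union> names s \<union> names s')"
    have w: "w \<notin> {y} \<union> fvs T \<union> names s" "w \<notin> {y} \<union> fvs T \<union> names s'"
      using fresh[of "{y} \<union> fvs T \<union> names s \<union> names s'"] unfolding w_def by auto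
    let ?g = "transpose x w"
    have inv: "?g (?g y) = y" "map (ren ?g) (map (ren ?g) T) = T"
      by (auto simp: ren_ren comp_def)
    have E: "dsub y T (ren ?g t) \<approx> map (ren ?g) (dsub (?g y) (map (ren ?g) T) t)" for t
      using l_sym[OF dsub_equivariant[of ?g "?g y" "map (ren ?g) T" t]] unfolding inv by simp
    have "map (ren ?g) (dsub (?g y) (map (ren ?g) T) s) \<approx> map (ren ?g) (dsub (?g y) (map (ren ?g) T) s')"
      using s_lam.IH by (intro ren_eqv) auto
    then have "dsub y T (ren ?g s) \<approx> dsub y T (ren ?g s')"
      using E l_sym l_trans by meson
    then show "dsub y T (RLam x s) \<approx> dsub y T (RLam x s')"
      using dsub_RLam_rename[OF w(1), of x] dsub_RLam_rename[OF w(2), of x] sum_lam_cong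
      by (meson l_sym l_trans)
  qed
next
  case (s_alpha y s x)
  show ?case
  proof (intro allI)
    fix u T
    define w where "w = fresh ({u} \<union> fvs T \<union> names s \<union> names (ren (id(x := y)) s))"
    have w: "w \<notin> {u} \<union> fvs T \<union> names s" "w \<notin> {u} \<union> fvs T \<union> names (ren (id(x := y)) s)"
      using fresh[of "{u} \<union> fvs T \<union> names s \<union> names (ren (id(x := y)) s)"] unfolding w_def by auto
    have "ren (transpose y w) (ren (id(x := y)) s) = ren (transpose x w) s"
      unfolding ren_ren using w s_alpha by (intro ren_cong) (auto simp: transpose_def)
    then show "dsub u T (RLam x s) \<approx> dsub u T (RLam y (ren (id(x := y)) s))"
      using dsub_RLam_rename[OF w(1), of x] dsub_RLam_rename[OF w(2), of y] 
      by (metis l_sym l_trans)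
  qed
next
  case (s_perm s t u)
  show ?case
  proof (intro allI)
    fix y T
    let ?s = "dsub y T s" and ?t = "dsub y T t" and ?u = "dsub y T u"
    have "dsub y T (RDif (RDif s t) u) = map (\<lambda>r. RDif (RDif r t) u) ?s
        @ map (\<lambda>r. RDif (RDif s r) u) ?t @ map (\<lambda>r. RDif (RDif s t) r) ?u"
      by (simp add: sum_dif_def comp_def)
    also have "\<dots> \<approx> map (\<lambda>r. RDif (RDif r u) t) ?s
        @ map (\<lambda>r. RDif (RDif s u) r) ?t @ map (\<lambda>r. RDif (RDif s r) t) ?u"
      by (intro l_append l_map_fun seqv_leqv.s_perm)
    also have "\<dots> \<approx> map (\<lambda>r. RDif (RDif r u) t) ?s
        @ map (\<lambda>r. RDif (RDif s r) t) ?u @ map (\<lambda>r. RDif (RDif s u) r) ?t"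
      by (rule l_mset) simp
    also have "\<dots> = dsub y T (RDif (RDif s u) t)"
      by (simp add: sum_dif_def comp_def)
    finally show "dsub y T (RDif (RDif s t) u) \<approx> dsub y T (RDif (RDif s u) t)" .
  qed
next
  case (s_app s s' T T')
  then show ?case
    by (auto simp: dsubs_def intro!: l_append sum_app_cong sum_dif_cong l_single)
next
  case (s_dif s s' t t')
  then show ?case by (auto intro!: l_append sum_dif_cong l_single)
next
  case (l_comm s t S)
  show ?case by (auto simp: dsubs_def intro: l_mset)
qed (auto simp: dsubs_def intro: l_refl l_sym l_append, (blast intro: l_trans l_sym)+)

text \<open>\<open>dsubst y T S\<close> is \<open>\<partial>S/\<partial>y \<cdot> T\<close> on equivalence classes of terms.\<close>

lift_definition dsubst :: "var \<Rightarrow> dterm \<Rightarrow> dterm \<Rightarrow> dterm" is dsubs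
proof -
  fix y T T' S S' assume "T \<approx> T'" "S \<approx> S'"
  have "dsubs y T S \<approx> dsubs y T' S"
    unfolding dsubs_def using \<open>T \<approx> T'\<close> by (intro l_concat_fun dsub_cong_left)
  then show "dsubs y T S \<approx> dsubs y T' S'"
    using dsubs_cong_right[OF \<open>S \<approx> S'\<close>] l_trans by blast
qed

lemma dsub_nary:
  "dsub y T (foldl RDif s us) =
     foldl sum_dif (dsub y T s) (map (\<lambda>u. [u]) us) @
     concat (map (\<lambda>i. foldl sum_dif [s] ((map (\<lambda>u. [u]) us)[i := dsub y T (us ! i)])) [0..<length us])"
proof (induction us rule: rev_induct)
  case (snoc u us)
  have single: "foldl sum_dif [s] (map (\<lambda>u. [u]) us) = [foldl RDif s us]" for us
    by (induction us rule: rev_induct) (auto simp: sum_dif_def)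
  have lin: "sum_dif (concat (map F is)) [u] = concat (map (\<lambda>i. sum_dif (F i) [u]) is)" for F :: "nat \<Rightarrow> raw" and "is"
    by (induction "is") (auto simp: sum_dif_def)
  have "sum_dif (A @ B) V = sum_dif A V @ sum_dif B V" for A B V by (simp add: sum_dif_def)
  with snoc show ?case 
    by (auto simp: single lin nth_append list_update_append intro!: arg_cong[where f = concat])
qed (simp add: sum_dif_def)

text \<open>The product and the terminal object are chosen structure. Arrows carry their domain and
  codomain, so \<open>\<langle>f, g\<rangle>\<close> and \<open>\<D> f\<close> need no object arguments; \<open>\<Lambda> X A f\<close> does, for
  \<open>f : X \<otimes> A \<rightarrow> B\<close>, since \<open>X \<otimes> A\<close> need not determine \<open>X\<close> and \<open>A\<close>.\<close>

record ('o, 'm) ccd_cat =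
  Ob :: "'o set"
  Ar :: "'m set"
  Dom :: "'m \<Rightarrow> 'o"
  Cod :: "'m \<Rightarrow> 'o"
  Ident :: "'o \<Rightarrow> 'm" ("\<I>\<index>")
  Comp :: "'m \<Rightarrow> 'm \<Rightarrow> 'm" (infixl "\<odot>\<index>" 70)
  Zero :: "'o \<Rightarrow> 'o \<Rightarrow> 'm" ("\<zero>\<index>")
  Plus :: "'m \<Rightarrow> 'm \<Rightarrow> 'm" (infixl "\<oplus>\<index>" 65)
  One :: "'o" ("\<one>\<index>")
  Bang :: "'o \<Rightarrow> 'm"
  Prod :: "'o \<Rightarrow> 'o \<Rightarrow> 'o" (infixl "\<otimes>\<index>" 75)
  Pi1 :: "'o \<Rightarrow> 'o \<Rightarrow> 'm" ("\<pi>\<^sub>1\<index>")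
  Pi2 :: "'o \<Rightarrow> 'o \<Rightarrow> 'm" ("\<pi>\<^sub>2\<index>")
  Pairing :: "'m \<Rightarrow> 'm \<Rightarrow> 'm" ("\<langle>_,/ _\<rangle>\<index>")
  Exp :: "'o \<Rightarrow> 'o \<Rightarrow> 'o" ("[_ \<Rightarrow>\<index> _]")
  Ev :: "'o \<Rightarrow> 'o \<Rightarrow> 'm" ("ev\<index>")
  Cur :: "'o \<Rightarrow> 'o \<Rightarrow> 'm \<Rightarrow> 'm" ("\<Lambda>\<index>")
  Der :: "'m \<Rightarrow> 'm" ("\<D>\<index>")

definition hom :: "('o, 'm, 'z) ccd_cat_scheme \<Rightarrow> 'o \<Rightarrow> 'o \<Rightarrow> 'm set" where
  "hom C A B = {f \<in> Ar C. Dom C f = A \<and> Cod C f = B}"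

definition cross :: "('o, 'm, 'z) ccd_cat_scheme \<Rightarrow> 'm \<Rightarrow> 'm \<Rightarrow> 'm" (infixl "\<boxtimes>\<index>" 75) where
  "f \<boxtimes>\<^bsub>C\<^esub> g =
     \<langle>f \<odot>\<^bsub>C\<^esub> \<pi>\<^sub>1\<^bsub>C\<^esub> (Dom C f) (Dom C g), g \<odot>\<^bsub>C\<^esub> \<pi>\<^sub>2\<^bsub>C\<^esub> (Dom C f) (Dom C g)\<rangle>\<^bsub>C\<^esub>"

definition additive :: "('o, 'm, 'z) ccd_cat_scheme \<Rightarrow> 'm \<Rightarrow> bool" where
  "additive C f \<longleftrightarrow>
     (\<forall>X\<in>Ob C. \<forall>g\<in>hom C X (Dom C f). \<forall>h\<in>hom C X (Dom C f).
        f \<odot>\<^bsub>C\<^esub> (g \<oplus>\<^bsub>C\<^esub> h) = f \<odot>\<^bsub>C\<^esub> g \<oplus>\<^bsub>C\<^esub> f \<odot>\<^bsub>C\<^esub> h) \<and>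
     (\<forall>X\<in>Ob C. f \<odot>\<^bsub>C\<^esub> \<zero>\<^bsub>C\<^esub> X (Dom C f) = \<zero>\<^bsub>C\<^esub> X (Cod C f))"

definition linear :: "('o, 'm, 'z) ccd_cat_scheme \<Rightarrow> 'm \<Rightarrow> bool" where
  "linear C f \<longleftrightarrow> \<D>\<^bsub>C\<^esub> f = f \<odot>\<^bsub>C\<^esub> \<pi>\<^sub>1\<^bsub>C\<^esub> (Dom C f) (Dom C f)"

locale category =
  fixes C :: "('o, 'm, 'z) ccd_cat_scheme" (structure)
  assumes dom_Ob: "f \<in> Ar C \<Longrightarrow> Dom C f \<in> Ob C"
    and cod_Ob: "f \<in> Ar C \<Longrightarrow> Cod C f \<in> Ob C"
    and Id_hom: "A \<in> Ob C \<Longrightarrow> \<I> A \<in> hom C A A"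
    and comp_hom: "\<lbrakk>g \<in> hom C B E; f \<in> hom C A B\<rbrakk> \<Longrightarrow> g \<odot> f \<in> hom C A E"
    and comp_assoc: "\<lbrakk>h \<in> hom C E F; g \<in> hom C B E; f \<in> hom C A B\<rbrakk> \<Longrightarrow> h \<odot> g \<odot> f = h \<odot> (g \<odot> f)"
    and comp_Id: "f \<in> hom C A B \<Longrightarrow> f \<odot> \<I> A = f"
    and Id_comp: "f \<in> hom C A B \<Longrightarrow> \<I> B \<odot> f = f"

locale left_additive_category = category +
  assumes zero_hom: "\<lbrakk>A \<in> Ob C; B \<in> Ob C\<rbrakk> \<Longrightarrow> \<zero> A B \<in> hom C A B"
    and plus_hom: "\<lbrakk>f \<in> hom C A B; g \<in> hom C A B\<rbrakk> \<Longrightarrow> f \<oplus> g \<in> hom C A B"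
    and plus_assoc: "\<lbrakk>f \<in> hom C A B; g \<in> hom C A B; h \<in> hom C A B\<rbrakk> \<Longrightarrow> f \<oplus> g \<oplus> h = f \<oplus> (g \<oplus> h)"
    and plus_comm: "\<lbrakk>f \<in> hom C A B; g \<in> hom C A B\<rbrakk> \<Longrightarrow> f \<oplus> g = g \<oplus> f"
    and zero_plus: "f \<in> hom C A B \<Longrightarrow> \<zero> A B \<oplus> f = f"
    and plus_comp: "\<lbrakk>g \<in> hom C A B; h \<in> hom C A B; f \<in> hom C X A\<rbrakk> \<Longrightarrow> (g \<oplus> h) \<odot> f = g \<odot> f \<oplus> h \<odot> f"
    and zero_comp: "\<lbrakk>B \<in> Ob C; f \<in> hom C X A\<rbrakk> \<Longrightarrow> \<zero> A B \<odot> f = \<zero> X B"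

locale cartesian_left_additive_category = left_additive_category +
  assumes One_Ob: "\<one> \<in> Ob C"
    and Bang_hom: "A \<in> Ob C \<Longrightarrow> Bang C A \<in> hom C A \<one>"
    and Bang_unique: "f \<in> hom C A \<one> \<Longrightarrow> f = Bang C A"
    and Prod_Ob: "\<lbrakk>A \<in> Ob C; B \<in> Ob C\<rbrakk> \<Longrightarrow> A \<otimes> B \<in> Ob C"
    and Pi1_hom: "\<lbrakk>A \<in> Ob C; B \<in> Ob C\<rbrakk> \<Longrightarrow> \<pi>\<^sub>1 A B \<in> hom C (A \<otimes> B) A"
    and Pi2_hom: "\<lbrakk>A \<in> Ob C; B \<in> Ob C\<rbrakk> \<Longrightarrow> \<pi>\<^sub>2 A B \<in> hom C (A \<otimes> B) B"
    and Pair_hom: "\<lbrakk>f \<in> hom C X A; g \<in> hom C X B\<rbrakk> \<Longrightarrow> \<langle>f, g\<rangle> \<in> hom C X (A \<otimes> B)"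
    and Pi1_Pair: "\<lbrakk>f \<in> hom C X A; g \<in> hom C X B\<rbrakk> \<Longrightarrow> \<pi>\<^sub>1 A B \<odot> \<langle>f, g\<rangle> = f"
    and Pi2_Pair: "\<lbrakk>f \<in> hom C X A; g \<in> hom C X B\<rbrakk> \<Longrightarrow> \<pi>\<^sub>2 A B \<odot> \<langle>f, g\<rangle> = g"
    and Pair_unique: "\<lbrakk>A \<in> Ob C; B \<in> Ob C; h \<in> hom C X (A \<otimes> B)\<rbrakk>
          \<Longrightarrow> h = \<langle>\<pi>\<^sub>1 A B \<odot> h, \<pi>\<^sub>2 A B \<odot> h\<rangle>"
    and Pi1_additive: "\<lbrakk>A \<in> Ob C; B \<in> Ob C\<rbrakk> \<Longrightarrow> additive C (\<pi>\<^sub>1 A B)"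
    and Pi2_additive: "\<lbrakk>A \<in> Ob C; B \<in> Ob C\<rbrakk> \<Longrightarrow> additive C (\<pi>\<^sub>2 A B)"
    and Pair_additive: "\<lbrakk>f \<in> hom C X A; g \<in> hom C X B; additive C f; additive C g\<rbrakk>
          \<Longrightarrow> additive C \<langle>f, g\<rangle>"

locale cartesian_differential_category = cartesian_left_additive_category +
  assumes D_hom: "f \<in> hom C A B \<Longrightarrow> \<D> f \<in> hom C (A \<otimes> A) B"
    and D1_plus: "\<lbrakk>f \<in> hom C A B; g \<in> hom C A B\<rbrakk> \<Longrightarrow> \<D> (f \<oplus> g) = \<D> f \<oplus> \<D> g"
    and D1_zero: "\<lbrakk>A \<in> Ob C; B \<in> Ob C\<rbrakk> \<Longrightarrow> \<D> (\<zero> A B) = \<zero> (A \<otimes> A) B"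
    and D2_plus: "\<lbrakk>f \<in> hom C A B; h \<in> hom C X A; k \<in> hom C X A; v \<in> hom C X A\<rbrakk>
          \<Longrightarrow> \<D> f \<odot> \<langle>h \<oplus> k, v\<rangle> = \<D> f \<odot> \<langle>h, v\<rangle> \<oplus> \<D> f \<odot> \<langle>k, v\<rangle>"
    and D2_zero: "\<lbrakk>f \<in> hom C A B; v \<in> hom C X A\<rbrakk> \<Longrightarrow> \<D> f \<odot> \<langle>\<zero> X A, v\<rangle> = \<zero> X B"
    and D3_Id: "A \<in> Ob C \<Longrightarrow> \<D> (\<I> A) = \<pi>\<^sub>1 A A"
    and D3_Pi1: "\<lbrakk>A \<in> Ob C; B \<in> Ob C\<rbrakk> \<Longrightarrow> \<D> (\<pi>\<^sub>1 A B) = \<pi>\<^sub>1 A B \<odot> \<pi>\<^sub>1 (A \<otimes> B) (A \<otimes> B)"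
    and D3_Pi2: "\<lbrakk>A \<in> Ob C; B \<in> Ob C\<rbrakk> \<Longrightarrow> \<D> (\<pi>\<^sub>2 A B) = \<pi>\<^sub>2 A B \<odot> \<pi>\<^sub>1 (A \<otimes> B) (A \<otimes> B)"
    and D4: "\<lbrakk>f \<in> hom C X A; g \<in> hom C X B\<rbrakk> \<Longrightarrow> \<D> \<langle>f, g\<rangle> = \<langle>\<D> f, \<D> g\<rangle>"
    and D5: "\<lbrakk>f \<in> hom C A B; g \<in> hom C X A\<rbrakk> \<Longrightarrow> \<D> (f \<odot> g) = \<D> f \<odot> \<langle>\<D> g, g \<odot> \<pi>\<^sub>2 X X\<rangle>"
    and D6: "\<lbrakk>f \<in> hom C A B; g \<in> hom C X A; h \<in> hom C X A; k \<in> hom C X A\<rbrakk>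
          \<Longrightarrow> \<D> (\<D> f) \<odot> \<langle>\<langle>g, \<zero> X A\<rangle>, \<langle>h, k\<rangle>\<rangle> = \<D> f \<odot> \<langle>g, k\<rangle>"
    and D7: "\<lbrakk>f \<in> hom C A B; g \<in> hom C X A; h \<in> hom C X A; k \<in> hom C X A\<rbrakk>
          \<Longrightarrow> \<D> (\<D> f) \<odot> \<langle>\<langle>\<zero> X A, h\<rangle>, \<langle>g, k\<rangle>\<rangle> = \<D> (\<D> f) \<odot> \<langle>\<langle>\<zero> X A, g\<rangle>, \<langle>h, k\<rangle>\<rangle>"

locale cartesian_closed_differential_category = cartesian_differential_category +
  assumes Exp_Ob: "\<lbrakk>A \<in> Ob C; B \<in> Ob C\<rbrakk> \<Longrightarrow> [A \<Rightarrow> B] \<in> Ob C"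
    and Ev_hom: "\<lbrakk>A \<in> Ob C; B \<in> Ob C\<rbrakk> \<Longrightarrow> ev A B \<in> hom C ([A \<Rightarrow> B] \<otimes> A) B"
    and Cur_hom: "\<lbrakk>X \<in> Ob C; A \<in> Ob C; f \<in> hom C (X \<otimes> A) B\<rbrakk> \<Longrightarrow> \<Lambda> X A f \<in> hom C X [A \<Rightarrow> B]"
    and Ev_Cur: "\<lbrakk>X \<in> Ob C; A \<in> Ob C; f \<in> hom C (X \<otimes> A) B\<rbrakk> \<Longrightarrow> ev A B \<odot> (\<Lambda> X A f \<boxtimes> \<I> A) = f"
    and Cur_unique: "\<lbrakk>A \<in> Ob C; B \<in> Ob C; h \<in> hom C X [A \<Rightarrow> B]\<rbrakk> \<Longrightarrow> h = \<Lambda> X A (ev A B \<odot> (h \<boxtimes> \<I> A))"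
    and Cur_plus: "\<lbrakk>X \<in> Ob C; A \<in> Ob C; f \<in> hom C (X \<otimes> A) B; g \<in> hom C (X \<otimes> A) B\<rbrakk>
          \<Longrightarrow> \<Lambda> X A (f \<oplus> g) = \<Lambda> X A f \<oplus> \<Lambda> X A g"
    and Cur_zero: "\<lbrakk>X \<in> Ob C; A \<in> Ob C; B \<in> Ob C\<rbrakk> \<Longrightarrow> \<Lambda> X A (\<zero> (X \<otimes> A) B) = \<zero> X [A \<Rightarrow> B]"
    and D_Cur: "\<lbrakk>X \<in> Ob C; A \<in> Ob C; f \<in> hom C (X \<otimes> A) B\<rbrakk>
          \<Longrightarrow> \<D> (\<Lambda> X A f) = \<Lambda> (X \<otimes> X) A (\<D> f \<odot> \<langle>\<pi>\<^sub>1 X X \<boxtimes> \<zero> A A, \<pi>\<^sub>2 X X \<boxtimes> \<I> A\<rangle>)"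

definition uncur :: "('o, 'm, 'z) ccd_cat_scheme \<Rightarrow> 'o \<Rightarrow> 'o \<Rightarrow> 'm \<Rightarrow> 'm" ("\<Lambda>\<^sup>-\<index>") where
  "\<Lambda>\<^sup>-\<^bsub>C\<^esub> A B h = ev\<^bsub>C\<^esub> A B \<odot>\<^bsub>C\<^esub> (h \<boxtimes>\<^bsub>C\<^esub> \<I>\<^bsub>C\<^esub> A)"

text \<open>For \<open>f : X \<otimes> A \<rightarrow> B\<close> and \<open>g : X \<rightarrow> A\<close>; both objects are read off from \<open>g\<close>.\<close>

definition star :: "('o, 'm, 'z) ccd_cat_scheme \<Rightarrow> 'm \<Rightarrow> 'm \<Rightarrow> 'm" (infixl "\<star>\<index>" 70) where
  "f \<star>\<^bsub>C\<^esub> g =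
     (let X = Dom C g; A = Cod C g; XA = X \<otimes>\<^bsub>C\<^esub> A
      in \<D>\<^bsub>C\<^esub> f \<odot>\<^bsub>C\<^esub> \<langle>\<langle>\<zero>\<^bsub>C\<^esub> XA X, g \<odot>\<^bsub>C\<^esub> \<pi>\<^sub>1\<^bsub>C\<^esub> X A\<rangle>\<^bsub>C\<^esub>, \<I>\<^bsub>C\<^esub> XA\<rangle>\<^bsub>C\<^esub>)"

definition linear_reflexive_object ::
  "('o, 'm, 'z) ccd_cat_scheme \<Rightarrow> 'o \<Rightarrow> 'm \<Rightarrow> 'm \<Rightarrow> bool" where
  "linear_reflexive_object C U \<A> lam \<longleftrightarrow>
     U \<in> Ob C \<and>
     \<A> \<in> hom C U [U \<Rightarrow>\<^bsub>C\<^esub> U] \<and> lam \<in> hom C [U \<Rightarrow>\<^bsub>C\<^esub> U] U \<and>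
     \<A> \<odot>\<^bsub>C\<^esub> lam = \<I>\<^bsub>C\<^esub> [U \<Rightarrow>\<^bsub>C\<^esub> U] \<and>
     linear C \<A> \<and> linear C lam"

fun ctx :: "('o, 'm, 'z) ccd_cat_scheme \<Rightarrow> 'o \<Rightarrow> var list \<Rightarrow> 'o" where
  "ctx C U [] = \<one>\<^bsub>C\<^esub>"
| "ctx C U (x # xs) = ctx C U (butlast (x # xs)) \<otimes>\<^bsub>C\<^esub> U"

text \<open>For distinct \<open>xs\<close>, \<open>proj C U xs (xs ! i)\<close> is the \<open>i\<close>-th projection. With repetitions
  the last occurrence counts, so that an inner binder shadows an outer one. Outside the context the
  value is a zero map; this case does not arise when \<open>xs\<close> is adequate.\<close>

fun proj :: "('o, 'm, 'z) ccd_cat_scheme \<Rightarrow> 'o \<Rightarrow> var list \<Rightarrow> var \<Rightarrow> 'm" where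
  "proj C U [] z = \<zero>\<^bsub>C\<^esub> \<one>\<^bsub>C\<^esub> U"
| "proj C U (x # xs) z =
     (let ys = butlast (x # xs)
      in if z = last (x # xs) then \<pi>\<^sub>2\<^bsub>C\<^esub> (ctx C U ys) U
         else proj C U ys z \<odot>\<^bsub>C\<^esub> \<pi>\<^sub>1\<^bsub>C\<^esub> (ctx C U ys) U)"

definition sum_hom :: "('o, 'm, 'z) ccd_cat_scheme \<Rightarrow> 'o \<Rightarrow> 'o \<Rightarrow> 'm list \<Rightarrow> 'm" where
  "sum_hom C A B fs = foldr (Plus C) fs (\<zero>\<^bsub>C\<^esub> A B)"

fun sinterp :: "('o, 'm, 'z) ccd_cat_scheme \<Rightarrow> 'o \<Rightarrow> 'm \<Rightarrow> 'm \<Rightarrow> var list \<Rightarrow> simple \<Rightarrow> 'm" where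
  "sinterp C U \<A> lam xs (RVar x) = proj C U xs x"
| "sinterp C U \<A> lam xs (RLam z s) = lam \<odot>\<^bsub>C\<^esub> \<Lambda>\<^bsub>C\<^esub> (ctx C U xs) U (sinterp C U \<A> lam (xs @ [z]) s)"
| "sinterp C U \<A> lam xs (RApp s T) =
     ev\<^bsub>C\<^esub> U U \<odot>\<^bsub>C\<^esub> \<langle>\<A> \<odot>\<^bsub>C\<^esub> sinterp C U \<A> lam xs s,
                   sum_hom C (ctx C U xs) U (map (sinterp C U \<A> lam xs) T)\<rangle>\<^bsub>C\<^esub>"
| "sinterp C U \<A> lam xs (RDif s t) =
     lam \<odot>\<^bsub>C\<^esub> \<Lambda>\<^bsub>C\<^esub> (ctx C U xs) U
       (\<Lambda>\<^sup>-\<^bsub>C\<^esub> U U (\<A> \<odot>\<^bsub>C\<^esub> sinterp C U \<A> lam xs s) \<star>\<^bsub>C\<^esub> sinterp C U \<A> lam xs t)"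

definition rinterp :: "('o, 'm, 'z) ccd_cat_scheme \<Rightarrow> 'o \<Rightarrow> 'm \<Rightarrow> 'm \<Rightarrow> var list \<Rightarrow> raw \<Rightarrow> 'm" where
  "rinterp C U \<A> lam xs S = sum_hom C (ctx C U xs) U (map (sinterp C U \<A> lam xs) S)"

text \<open>Independence of the representative is \<open>interp_abs\<close> below.\<close>

definition interp :: "('o, 'm, 'z) ccd_cat_scheme \<Rightarrow> 'o \<Rightarrow> 'm \<Rightarrow> 'm \<Rightarrow> var list \<Rightarrow> dterm \<Rightarrow> 'm" where
  "interp C U \<A> lam xs S = rinterp C U \<A> lam xs (rep_dterm S)"

definition adequate :: "var list \<Rightarrow> dterm \<Rightarrow> bool" where
  "adequate xs S \<longleftrightarrow> FV S \<subseteq> set xs"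

lemma sum_hom_simps [simp]:
  "sum_hom C A B [] = \<zero>\<^bsub>C\<^esub> A B" "sum_hom C A B (f # fs) = f \<oplus>\<^bsub>C\<^esub> sum_hom C A B fs"
  by (auto simp: sum_hom_def)

lemma ctx_snoc [simp]: "ctx C U (xs @ [x]) = ctx C U xs \<otimes>\<^bsub>C\<^esub> U"
  by (cases xs) (auto simp: butlast_append)

lemma proj_snoc [simp]: "proj C U (xs @ [x]) z =
    (if z = x then \<pi>\<^sub>2\<^bsub>C\<^esub> (ctx C U xs) U else proj C U xs z \<odot>\<^bsub>C\<^esub> \<pi>\<^sub>1\<^bsub>C\<^esub> (ctx C U xs) U)"
  by (cases xs) (auto simp: butlast_append)

lemma ctx_length: "length xs = length ys \<Longrightarrow> ctx C U xs = ctx C U ys"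
proof (induction xs arbitrary: ys rule: rev_induct)
  case (snoc x xs)
  then obtain y ys' where "ys = ys' @ [y]" by (cases ys rule: rev_cases) auto
  with snoc show ?case by auto
qed simp

lemma sinterp_ren:
  assumes "length xs = length ys" and "inj_on f (names s)"
    and "\<And>v. v \<in> fv s \<Longrightarrow> proj C U ys (f v) = proj C U xs v"
  shows "sinterp C U \<A> lam ys (ren f s) = sinterp C U \<A> lam xs s"
  using assms
proof (induction s arbitrary: xs ys)
  case (RLam z s)
  have c: "ctx C U ys = ctx C U xs" using RLam.prems(1) ctx_length by metis
  have "sinterp C U \<A> lam (ys @ [f z]) (ren f s) = sinterp C U \<A> lam (xs @ [z]) s"
  proof (rule RLam.IH)
    show "inj_on f (names s)" using RLam.prems(2) by (auto intro: inj_on_subset)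
    fix v assume v: "v \<in> fv s"
    then have "f v = f z \<longleftrightarrow> v = z"
      using RLam.prems(2) fv_subset_names[of s] by (auto simp: inj_on_def)
    then show "proj C U (ys @ [f z]) (f v) = proj C U (xs @ [z]) v"
      using RLam.prems(3)[of v] v c by auto
  qed (use RLam.prems in auto)
  then show ?case using c by simp
next
  case (RApp s T)
  have "ctx C U ys = ctx C U xs" using RApp.prems(1) ctx_length by metis
  moreover have "sinterp C U \<A> lam ys (ren f s) = sinterp C U \<A> lam xs s"
    using RApp.prems by (intro RApp.IH(1)) (auto intro: inj_on_subset)
  moreover have "sinterp C U \<A> lam ys (ren f t) = sinterp C U \<A> lam xs t" if "t \<in> set T" for t
    using RApp.prems that by (intro RApp.IH(2)) (auto intro: inj_on_subset)
  ultimately show ?case by (auto simp: comp_def cong: map_cong)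
next
  case (RDif s t)
  have "ctx C U ys = ctx C U xs" using RDif.prems(1) ctx_length by metis
  moreover have "sinterp C U \<A> lam ys (ren f s) = sinterp C U \<A> lam xs s"
    "sinterp C U \<A> lam ys (ren f t) = sinterp C U \<A> lam xs t"
    using RDif.prems by (intro RDif.IH; auto intro: inj_on_subset)+
  ultimately show ?case by simp
qed simp

context cartesian_closed_differential_category
begin

lemma hom_Ob: "f \<in> hom C A B \<Longrightarrow> A \<in> Ob C" "f \<in> hom C A B \<Longrightarrow> B \<in> Ob C"
  using dom_Ob cod_Ob by (auto simp: hom_def)

lemma hom_Dom: "f \<in> hom C A B \<Longrightarrow> Dom C f = A" "f \<in> hom C A B \<Longrightarrow> Cod C f = B"
  by (auto simp: hom_def)

lemma Pair_comp:
  assumes "f \<in> hom C X A" "g \<in> hom C X B" "h \<in> hom C Y X"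
  shows "\<langle>f, g\<rangle> \<odot> h = \<langle>f \<odot> h, g \<odot> h\<rangle>"
proof -
  note ob = hom_Ob[OF assms(1)] hom_Ob[OF assms(2)]
  have p: "\<langle>f, g\<rangle> \<odot> h \<in> hom C Y (A \<otimes> B)" using assms Pair_hom comp_hom by blast
  have "\<pi>\<^sub>1 A B \<odot> (\<langle>f, g\<rangle> \<odot> h) = f \<odot> h"
    using comp_assoc[OF Pi1_hom[OF ob(2,4)] Pair_hom[OF assms(1,2)] assms(3)] Pi1_Pair[OF assms(1,2)] by simp
  moreover have "\<pi>\<^sub>2 A B \<odot> (\<langle>f, g\<rangle> \<odot> h) = g \<odot> h"
    using comp_assoc[OF Pi2_hom[OF ob(2,4)] Pair_hom[OF assms(1,2)] assms(3)] Pi2_Pair[OF assms(1,2)] by simp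
  ultimately show ?thesis using Pair_unique[OF ob(2,4) p] by simp
qed

lemma Pair_zero:
  assumes "X \<in> Ob C" "A \<in> Ob C" "B \<in> Ob C"
  shows "\<langle>\<zero> X A, \<zero> X B\<rangle> = \<zero> X (A \<otimes> B)"
proof -
  have "\<zero> X (A \<otimes> B) \<in> hom C X (A \<otimes> B)" using assms by (intro zero_hom Prod_Ob)
  moreover have "\<pi>\<^sub>1 A B \<odot> \<zero> X (A \<otimes> B) = \<zero> X A" "\<pi>\<^sub>2 A B \<odot> \<zero> X (A \<otimes> B) = \<zero> X B"
    using Pi1_additive[OF assms(2,3)] Pi2_additive[OF assms(2,3)] assms
      hom_Dom[OF Pi1_hom[OF assms(2,3)]] hom_Dom[OF Pi2_hom[OF assms(2,3)]]
    by (auto simp: additive_def)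
  ultimately show ?thesis using Pair_unique[OF assms(2,3), of "\<zero> X (A \<otimes> B)" X] by simp
qed

lemma star_eq:
  assumes "g \<in> hom C X A"
  shows "f \<star> g = \<D> f \<odot> \<langle>\<langle>\<zero> (X \<otimes> A) X, g \<odot> \<pi>\<^sub>1 X A\<rangle>, \<I> (X \<otimes> A)\<rangle>"
  using hom_Dom[OF assms] by (simp add: star_def Let_def)

lemma star_arg_hom:
  assumes "g \<in> hom C X A"
  shows "\<langle>\<langle>\<zero> (X \<otimes> A) X, g \<odot> \<pi>\<^sub>1 X A\<rangle>, \<I> (X \<otimes> A)\<rangle> \<in> hom C (X \<otimes> A) ((X \<otimes> A) \<otimes> (X \<otimes> A))"
  using hom_Ob[OF assms] assms by (intro Pair_hom zero_hom Id_hom Prod_Ob comp_hom[OF assms] Pi1_hom) auto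

lemma star_hom:
  assumes "f \<in> hom C (X \<otimes> A) B" "g \<in> hom C X A"
  shows "f \<star> g \<in> hom C (X \<otimes> A) B"
  unfolding star_eq[OF assms(2)] using D_hom[OF assms(1)] star_arg_hom[OF assms(2)] comp_hom by blast

lemma D_star_comp:
  assumes f: "f \<in> hom C (X \<otimes> A) B" and g: "g \<in> hom C X A" and h: "h \<in> hom C X A"
  defines "P \<equiv> X \<otimes> A"
  shows "f \<star> g \<star> h =
    \<D> (\<D> f) \<odot> \<langle>\<langle>\<zero> P P, \<langle>\<zero> P X, h \<odot> \<pi>\<^sub>1 X A\<rangle>\<rangle>, \<langle>\<langle>\<zero> P X, g \<odot> \<pi>\<^sub>1 X A\<rangle>, \<I> P\<rangle>\<rangle>"
proof -
  have X: "X \<in> Ob C" and A: "A \<in> Ob C" using hom_Ob[OF g] by auto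
  have P: "P \<in> Ob C" unfolding P_def using X A by (rule Prod_Ob)
  have PP: "P \<otimes> P \<in> Ob C" using P P by (rule Prod_Ob)
  have p1: "\<pi>\<^sub>1 X A \<in> hom C P X" unfolding P_def using X A by (rule Pi1_hom)
  have g1: "g \<odot> \<pi>\<^sub>1 X A \<in> hom C P A" and h1: "h \<odot> \<pi>\<^sub>1 X A \<in> hom C P A"
    using g h p1 comp_hom by blast+
  have z: "\<zero> P X \<in> hom C P X" using P X by (rule zero_hom)
  let ?a = "\<lambda>k. \<langle>\<zero> P X, k \<odot> \<pi>\<^sub>1 X A\<rangle>"
  let ?k = "\<lambda>k. \<langle>?a k, \<I> P\<rangle>"
  have ag: "?a g \<in> hom C P P" and ah: "?a h \<in> hom C P P"
    using Pair_hom[OF z g1] Pair_hom[OF z h1] by (auto simp: P_def)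
  have I: "\<I> P \<in> hom C P P" using P by (rule Id_hom)
  have kg: "?k g \<in> hom C P (P \<otimes> P)" and kh: "?k h \<in> hom C P (P \<otimes> P)"
    using Pair_hom[OF ag I] Pair_hom[OF ah I] .
  have q1: "\<pi>\<^sub>1 P P \<in> hom C (P \<otimes> P) P" and q2: "\<pi>\<^sub>2 P P \<in> hom C (P \<otimes> P) P"
    using Pi1_hom[OF P P] Pi2_hom[OF P P] .
  have Df: "\<D> f \<in> hom C (P \<otimes> P) B" using D_hom[OF f] by (simp add: P_def)
  have "\<D> (g \<odot> \<pi>\<^sub>1 X A) \<odot> ?k h = \<D> g \<odot> (\<langle>\<pi>\<^sub>1 X A \<odot> \<pi>\<^sub>1 P P, \<pi>\<^sub>1 X A \<odot> \<pi>\<^sub>2 P P\<rangle> \<odot> ?k h)"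
    using D5[OF g p1] D3_Pi1[OF X A] comp_assoc[OF D_hom[OF g] Pair_hom[OF comp_hom[OF p1 q1] comp_hom[OF p1 q2]] kh]
    by (simp add: P_def)
  also have "\<langle>\<pi>\<^sub>1 X A \<odot> \<pi>\<^sub>1 P P, \<pi>\<^sub>1 X A \<odot> \<pi>\<^sub>2 P P\<rangle> \<odot> ?k h = \<langle>\<pi>\<^sub>1 X A \<odot> ?a h, \<pi>\<^sub>1 X A \<odot> \<I> P\<rangle>"
    using Pair_comp[OF comp_hom[OF p1 q1] comp_hom[OF p1 q2] kh]
      comp_assoc[OF p1 q1 kh] comp_assoc[OF p1 q2 kh] Pi1_Pair[OF ah I] Pi2_Pair[OF ah I] by simp
  also have "\<dots> = \<langle>\<zero> P X, \<pi>\<^sub>1 X A\<rangle>"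
    using Pi1_Pair[OF z h1] comp_Id[OF p1] by simp
  also have "\<D> g \<odot> \<dots> = \<zero> P A" by (rule D2_zero[OF g p1])
  finally have *: "\<D> (g \<odot> \<pi>\<^sub>1 X A) \<odot> ?k h = \<zero> P A" .
  have Dg1: "\<D> (g \<odot> \<pi>\<^sub>1 X A) \<in> hom C (P \<otimes> P) A" by (rule D_hom[OF g1])
  have zz: "\<zero> (P \<otimes> P) X \<in> hom C (P \<otimes> P) X" by (rule zero_hom[OF PP X])
  have Dk: "\<D> (?k g) = \<langle>\<langle>\<zero> (P \<otimes> P) X, \<D> (g \<odot> \<pi>\<^sub>1 X A)\<rangle>, \<pi>\<^sub>1 P P\<rangle>"
    using D4[OF ag I] D4[OF z g1] D1_zero[OF P X] D3_Id[OF P] by simp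
  have in1: "\<langle>\<zero> (P \<otimes> P) X, \<D> (g \<odot> \<pi>\<^sub>1 X A)\<rangle> \<in> hom C (P \<otimes> P) P"
    using Pair_hom[OF zz Dg1] by (simp add: P_def)
  have Dkh: "\<D> (?k g) \<in> hom C (P \<otimes> P) (P \<otimes> P)" by (rule D_hom[OF kg])
  have "\<D> (?k g) \<odot> ?k h = \<langle>\<langle>\<zero> P X, \<zero> P A\<rangle>, ?a h\<rangle>"
    unfolding Dk using Pair_comp[OF in1 q1 kh] Pair_comp[OF zz Dg1 kh] zero_comp[OF X kh] * Pi1_Pair[OF ah I]
    by simp
  also have "\<langle>\<zero> P X, \<zero> P A\<rangle> = \<zero> P P" using Pair_zero[OF P X A] by (simp add: P_def)
  finally have 1: "\<D> (?k g) \<odot> ?k h = \<langle>\<zero> P P, ?a h\<rangle>" .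
  have 2: "(?k g \<odot> \<pi>\<^sub>2 P P) \<odot> ?k h = ?k g"
    using comp_assoc[OF kg q2 kh] Pi2_Pair[OF ah I] comp_Id[OF kg] by simp
  have kq: "?k g \<odot> \<pi>\<^sub>2 P P \<in> hom C (P \<otimes> P) (P \<otimes> P)" by (rule comp_hom[OF kg q2])
  have "f \<star> g \<star> h = \<D> (\<D> f \<odot> ?k g) \<odot> ?k h"
    using star_eq[OF g] star_eq[OF h] by (simp add: P_def)
  also have "\<dots> = \<D> (\<D> f) \<odot> (\<langle>\<D> (?k g), ?k g \<odot> \<pi>\<^sub>2 P P\<rangle> \<odot> ?k h)"
    using D5[OF Df kg] comp_assoc[OF D_hom[OF Df] Pair_hom[OF Dkh kq] kh] by simp
  also have "\<langle>\<D> (?k g), ?k g \<odot> \<pi>\<^sub>2 P P\<rangle> \<odot> ?k h = \<langle>\<langle>\<zero> P P, ?a h\<rangle>, ?k g\<rangle>"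
    using Pair_comp[OF Dkh kq kh] 1 2 by simp
  finally show ?thesis .
qed

lemma star_commute:
  assumes "f \<in> hom C (X \<otimes> A) B" "g \<in> hom C X A" "h \<in> hom C X A"
  shows "f \<star> g \<star> h = f \<star> h \<star> g"
proof -
  have X: "X \<in> Ob C" and A: "A \<in> Ob C" using hom_Ob[OF assms(2)] by auto
  have P: "X \<otimes> A \<in> Ob C" using X A by (rule Prod_Ob)
  have a: "\<langle>\<zero> (X \<otimes> A) X, k \<odot> \<pi>\<^sub>1 X A\<rangle> \<in> hom C (X \<otimes> A) (X \<otimes> A)" if "k \<in> hom C X A" for k
    using that Pair_hom[OF zero_hom[OF P X] comp_hom[OF that Pi1_hom[OF X A]]] by simp
  show ?thesis
    using D_star_comp[OF assms] D_star_comp[OF assms(1,3,2)]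
      D7[OF assms(1) a[OF assms(2)] a[OF assms(3)] Id_hom[OF P]] by simp
qed

lemma cross_Id_hom:
  assumes "h \<in> hom C X Y" "A \<in> Ob C"
  shows "h \<boxtimes> \<I> A \<in> hom C (X \<otimes> A) (Y \<otimes> A)"
proof -
  have X: "X \<in> Ob C" using hom_Ob[OF assms(1)] by auto
  show ?thesis unfolding cross_def hom_Dom[OF assms(1)] hom_Dom[OF Id_hom[OF assms(2)]]
    using comp_hom[OF assms(1) Pi1_hom[OF X assms(2)]] comp_hom[OF Id_hom[OF assms(2)] Pi2_hom[OF X assms(2)]]
    by (rule Pair_hom)
qed

lemma uncur_hom:
  assumes "h \<in> hom C X [A \<Rightarrow> B]" "A \<in> Ob C" "B \<in> Ob C"
  shows "\<Lambda>\<^sup>- A B h \<in> hom C (X \<otimes> A) B"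
  unfolding uncur_def using comp_hom[OF Ev_hom cross_Id_hom] assms by blast

lemma sum_hom_hom:
  "A \<in> Ob C \<Longrightarrow> B \<in> Ob C \<Longrightarrow> set fs \<subseteq> hom C A B \<Longrightarrow> sum_hom C A B fs \<in> hom C A B"
  by (induction fs) (auto intro: zero_hom plus_hom)

lemma plus_left_comm:
  "f \<in> hom C A B \<Longrightarrow> g \<in> hom C A B \<Longrightarrow> h \<in> hom C A B \<Longrightarrow> f \<oplus> (g \<oplus> h) = g \<oplus> (f \<oplus> h)"
  using plus_assoc[of f A B g h] plus_assoc[of g A B f h] plus_comm[of f A B g] by simp

lemma ctx_Ob: "U \<in> Ob C \<Longrightarrow> ctx C U xs \<in> Ob C"
  by (induction xs rule: rev_induct) (auto intro: One_Ob Prod_Ob)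

lemma proj_hom: "U \<in> Ob C \<Longrightarrow> proj C U xs x \<in> hom C (ctx C U xs) U"
proof (induction xs rule: rev_induct)
  case (snoc z xs)
  then show ?case
    using comp_hom[OF snoc.IH Pi1_hom] Pi2_hom ctx_Ob by simp
qed (simp add: One_Ob zero_hom)

context
  fixes U \<A> lam
  assumes lro: "linear_reflexive_object C U \<A> lam"
begin

lemma lroD:
  "U \<in> Ob C" "\<A> \<in> hom C U [U \<Rightarrow> U]" "lam \<in> hom C [U \<Rightarrow> U] U" "\<A> \<odot> lam = \<I> [U \<Rightarrow> U]"
  using lro by (auto simp: linear_reflexive_object_def)

lemma sinterp_hom: "sinterp C U \<A> lam xs s \<in> hom C (ctx C U xs) U"
proof (induction s arbitrary: xs)
  case (RVar x)
  then show ?case by (simp add: proj_hom lroD)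
next
  case (RLam z s)
  show ?case using RLam[of "xs @ [z]"] by (simp add: comp_hom[OF lroD(3)] Cur_hom lroD(1) ctx_Ob)
next
  case (RApp s T)
  then have "sum_hom C (ctx C U xs) U (map (sinterp C U \<A> lam xs) T) \<in> hom C (ctx C U xs) U"
    by (intro sum_hom_hom) (auto intro: ctx_Ob lroD)
  then show ?case using RApp(1)[of xs]
    by (auto intro!: comp_hom[OF Ev_hom] Pair_hom comp_hom[OF lroD(2)] lroD(1))
next
  case (RDif s t)
  show ?case 
    using RDif[of xs] by (auto intro!: comp_hom[OF lroD(3)] Cur_hom star_hom uncur_hom comp_hom[OF lroD(2)] lroD(1) ctx_Ob)
qed

lemma rinterp_hom: "rinterp C U \<A> lam xs S \<in> hom C (ctx C U xs) U"
  unfolding rinterp_def using sinterp_hom by (intro sum_hom_hom) (auto intro: ctx_Ob lroD)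

lemma uncur_sinterp:
  assumes "f \<in> hom C (X \<otimes> U) U" "X \<in> Ob C"
  shows "\<Lambda>\<^sup>- U U (\<A> \<odot> (lam \<odot> \<Lambda> X U f)) = f"
proof -
  have c: "\<Lambda> X U f \<in> hom C X [U \<Rightarrow> U]" using assms lroD(1) by (intro Cur_hom)
  then have "\<A> \<odot> (lam \<odot> \<Lambda> X U f) = \<Lambda> X U f"
    using comp_assoc[OF lroD(2,3) c] lroD(4) Id_comp[OF c] by simp
  then show ?thesis using Ev_Cur[OF assms(2) lroD(1) assms(1)] by (simp add: uncur_def)
qed

lemma sinterp_respects:
  "s \<simeq> t \<Longrightarrow> \<forall>xs. sinterp C U \<A> lam xs s = sinterp C U \<A> lam xs t" and
  rinterp_respects: "S \<approx> T \<Longrightarrow> \<forall>xs. rinterp C U \<A> lam xs S = rinterp C U \<A> lam xs T"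
proof (induction rule: seqv_leqv.inducts)
  case (s_alpha y s x)
  have "sinterp C U \<A> lam (xs @ [y]) (ren (id(x := y)) s) = sinterp C U \<A> lam (xs @ [x]) s" for xs
    using s_alpha fv_subset_names[of s] by (intro sinterp_ren inj_on_upd) auto
  then show ?case by simp
next
  case (s_perm s t u)
  show ?case
  proof
    fix xs
    let ?I = "sinterp C U \<A> lam xs" and ?X = "ctx C U xs"
    have X: "?X \<in> Ob C" by (rule ctx_Ob[OF lroD(1)])
    have f: "\<Lambda>\<^sup>- U U (\<A> \<odot> ?I s) \<in> hom C (?X \<otimes> U) U"
      using sinterp_hom by (intro uncur_hom comp_hom[OF lroD(2)] lroD(1))
    show "?I (RDif (RDif s t) u) = ?I (RDif (RDif s u) t)"
      using uncur_sinterp[OF star_hom[OF f sinterp_hom] X] star_commute[OF f sinterp_hom sinterp_hom] by simp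
  qed
next
  case (l_comm s t S)
  show ?case using plus_left_comm[OF sinterp_hom sinterp_hom rinterp_hom] by (simp add: rinterp_def)
qed (auto simp: rinterp_def)

lemma interp_abs: "interp C U \<A> lam xs (abs_dterm S) = rinterp C U \<A> lam xs S"
  unfolding interp_def using rinterp_respects[OF Quotient3_rep_abs[OF Quotient3_dterm], of S] l_refl by auto

end

end

end

theory Submission
  imports Defs
begin

text \<open>The induction on \<open>s\<close> goes through for derivatives along an arbitrary endomorphism \<open>d\<close> of the
  context: \<open>\<lbrakk>\<partial>s/\<partial>y \<cdot> T\<rbrakk> = D\<lbrakk>s\<rbrakk> \<circ> \<langle>d, Id\<rangle>\<close> whenever the \<open>y\<close>-component of \<open>d\<close> is \<open>\<lbrakk>T\<rbrakk>\<close> and its other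
  components are \<open>0\<close>. Under an abstraction \<open>d\<close> becomes \<open>\<langle>d \<circ> \<pi>\<^sub>1, 0\<rangle>\<close>, so no exchange of context variables
  is needed. For an application, the chain rule for \<open>ev\<close> splits into its linear part in the function
  and its derivative in the argument. For \<open>D s \<cdot> t\<close>, the axioms D2, D6 and D7 give a Leibniz rule for
  \<open>f \<star> g\<close>, because the bound coordinate in which \<open>f \<star> g\<close> differentiates is one on which \<open>d \<circ> \<pi>\<^sub>1\<close> does
  not depend.\<close>

context cartesian_closed_differential_category
begin

section \<open>Rewriting rules for typed arrows\<close>

text \<open>Typing conditions are phrased with \<open>Dom\<close> and \<open>Cod\<close> instead of \<open>hom\<close>, so that the simplifier can
  discharge them by computation, without guessing intermediate objects.\<close>

lemma arrow_simps:
  "f \<in> Ar C \<Longrightarrow> Dom C f \<in> Ob C"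
  "f \<in> Ar C \<Longrightarrow> Cod C f \<in> Ob C"
  "A \<in> Ob C \<Longrightarrow> B \<in> Ob C \<Longrightarrow> A \<otimes> B \<in> Ob C"
  "A \<in> Ob C \<Longrightarrow> B \<in> Ob C \<Longrightarrow> [A \<Rightarrow> B] \<in> Ob C"
  "A \<in> Ob C \<Longrightarrow> \<I> A \<in> Ar C" "A \<in> Ob C \<Longrightarrow> Dom C (\<I> A) = A" "A \<in> Ob C \<Longrightarrow> Cod C (\<I> A) = A"
  "\<lbrakk>g \<in> Ar C; f \<in> Ar C; Dom C g = Cod C f\<rbrakk> \<Longrightarrow> g \<odot> f \<in> Ar C"
  "\<lbrakk>g \<in> Ar C; f \<in> Ar C; Dom C g = Cod C f\<rbrakk> \<Longrightarrow> Dom C (g \<odot> f) = Dom C f"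
  "\<lbrakk>g \<in> Ar C; f \<in> Ar C; Dom C g = Cod C f\<rbrakk> \<Longrightarrow> Cod C (g \<odot> f) = Cod C g"
  "\<lbrakk>A \<in> Ob C; B \<in> Ob C\<rbrakk> \<Longrightarrow> \<zero> A B \<in> Ar C"
  "\<lbrakk>A \<in> Ob C; B \<in> Ob C\<rbrakk> \<Longrightarrow> Dom C (\<zero> A B) = A"
  "\<lbrakk>A \<in> Ob C; B \<in> Ob C\<rbrakk> \<Longrightarrow> Cod C (\<zero> A B) = B"
  "\<lbrakk>f \<in> Ar C; g \<in> Ar C; Dom C f = Dom C g; Cod C f = Cod C g\<rbrakk> \<Longrightarrow> f \<oplus> g \<in> Ar C"
  "\<lbrakk>f \<in> Ar C; g \<in> Ar C; Dom C f = Dom C g; Cod C f = Cod C g\<rbrakk> \<Longrightarrow> Dom C (f \<oplus> g) = Dom C g"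
  "\<lbrakk>f \<in> Ar C; g \<in> Ar C; Dom C f = Dom C g; Cod C f = Cod C g\<rbrakk> \<Longrightarrow> Cod C (f \<oplus> g) = Cod C g"
  "\<lbrakk>A \<in> Ob C; B \<in> Ob C\<rbrakk> \<Longrightarrow> \<pi>\<^sub>1 A B \<in> Ar C"
  "\<lbrakk>A \<in> Ob C; B \<in> Ob C\<rbrakk> \<Longrightarrow> Dom C (\<pi>\<^sub>1 A B) = A \<otimes> B"
  "\<lbrakk>A \<in> Ob C; B \<in> Ob C\<rbrakk> \<Longrightarrow> Cod C (\<pi>\<^sub>1 A B) = A"
  "\<lbrakk>A \<in> Ob C; B \<in> Ob C\<rbrakk> \<Longrightarrow> \<pi>\<^sub>2 A B \<in> Ar C"
  "\<lbrakk>A \<in> Ob C; B \<in> Ob C\<rbrakk> \<Longrightarrow> Dom C (\<pi>\<^sub>2 A B) = A \<otimes> B"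
  "\<lbrakk>A \<in> Ob C; B \<in> Ob C\<rbrakk> \<Longrightarrow> Cod C (\<pi>\<^sub>2 A B) = B"
  "\<lbrakk>f \<in> Ar C; g \<in> Ar C; Dom C f = Dom C g\<rbrakk> \<Longrightarrow> \<langle>f, g\<rangle> \<in> Ar C"
  "\<lbrakk>f \<in> Ar C; g \<in> Ar C; Dom C f = Dom C g\<rbrakk> \<Longrightarrow> Dom C \<langle>f, g\<rangle> = Dom C g"
  "\<lbrakk>f \<in> Ar C; g \<in> Ar C; Dom C f = Dom C g\<rbrakk> \<Longrightarrow> Cod C \<langle>f, g\<rangle> = Cod C f \<otimes> Cod C g"
  "f \<in> Ar C \<Longrightarrow> \<D> f \<in> Ar C"
  "f \<in> Ar C \<Longrightarrow> Dom C (\<D> f) = Dom C f \<otimes> Dom C f"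
  "f \<in> Ar C \<Longrightarrow> Cod C (\<D> f) = Cod C f"
  "\<lbrakk>A \<in> Ob C; B \<in> Ob C\<rbrakk> \<Longrightarrow> ev A B \<in> Ar C"
  "\<lbrakk>A \<in> Ob C; B \<in> Ob C\<rbrakk> \<Longrightarrow> Dom C (ev A B) = [A \<Rightarrow> B] \<otimes> A"
  "\<lbrakk>A \<in> Ob C; B \<in> Ob C\<rbrakk> \<Longrightarrow> Cod C (ev A B) = B"
  "\<lbrakk>X \<in> Ob C; A \<in> Ob C; f \<in> Ar C; Dom C f = X \<otimes> A\<rbrakk> \<Longrightarrow> \<Lambda> X A f \<in> Ar C"
  "\<lbrakk>X \<in> Ob C; A \<in> Ob C; f \<in> Ar C; Dom C f = X \<otimes> A\<rbrakk> \<Longrightarrow> Dom C (\<Lambda> X A f) = X"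
  "\<lbrakk>X \<in> Ob C; A \<in> Ob C; f \<in> Ar C; Dom C f = X \<otimes> A\<rbrakk> \<Longrightarrow> Cod C (\<Lambda> X A f) = [A \<Rightarrow> Cod C f]"
  using dom_Ob cod_Ob Prod_Ob Exp_Ob Id_hom comp_hom zero_hom plus_hom Pi1_hom Pi2_hom Pair_hom
    D_hom Ev_hom Cur_hom
  unfolding hom_def by (simp; fail)+

lemma comp_simps:
  "\<lbrakk>h \<in> Ar C; g \<in> Ar C; f \<in> Ar C; Dom C h = Cod C g; Dom C g = Cod C f\<rbrakk>
    \<Longrightarrow> h \<odot> g \<odot> f = h \<odot> (g \<odot> f)"
  "f \<in> Ar C \<Longrightarrow> Dom C f = A \<Longrightarrow> f \<odot> \<I> A = f"
  "f \<in> Ar C \<Longrightarrow> Cod C f = A \<Longrightarrow> \<I> A \<odot> f = f"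
  "\<lbrakk>f \<in> Ar C; Cod C f = A; B \<in> Ob C\<rbrakk> \<Longrightarrow> \<zero> A B \<odot> f = \<zero> (Dom C f) B"
  "\<lbrakk>g \<in> Ar C; h \<in> Ar C; f \<in> Ar C; Dom C g = Cod C f; Dom C h = Cod C f; Cod C g = Cod C h\<rbrakk>
    \<Longrightarrow> (g \<oplus> h) \<odot> f = g \<odot> f \<oplus> h \<odot> f"
  "\<lbrakk>f \<in> Ar C; Dom C f = X; Cod C f = A\<rbrakk> \<Longrightarrow> \<zero> X A \<oplus> f = f"
  "\<lbrakk>f \<in> Ar C; Dom C f = X; Cod C f = A\<rbrakk> \<Longrightarrow> f \<oplus> \<zero> X A = f"
  "\<lbrakk>f \<in> Ar C; g \<in> Ar C; h \<in> Ar C; Dom C f = Dom C g; Dom C g = Cod C h\<rbrakk>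
    \<Longrightarrow> \<langle>f, g\<rangle> \<odot> h = \<langle>f \<odot> h, g \<odot> h\<rangle>"
  "\<lbrakk>f \<in> Ar C; g \<in> Ar C; Dom C f = Dom C g; Cod C f = A; Cod C g = B\<rbrakk> \<Longrightarrow> \<pi>\<^sub>1 A B \<odot> \<langle>f, g\<rangle> = f"
  "\<lbrakk>f \<in> Ar C; g \<in> Ar C; Dom C f = Dom C g; Cod C f = A; Cod C g = B\<rbrakk> \<Longrightarrow> \<pi>\<^sub>2 A B \<odot> \<langle>f, g\<rangle> = g"
  "\<lbrakk>A \<in> Ob C; B \<in> Ob C\<rbrakk> \<Longrightarrow> \<langle>\<pi>\<^sub>1 A B, \<pi>\<^sub>2 A B\<rangle> = \<I> (A \<otimes> B)"
  subgoal using comp_assoc by (simp add: hom_def)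
  subgoal using comp_Id by (auto simp: hom_def)
  subgoal using Id_comp by (auto simp: hom_def)
  subgoal using zero_comp by (auto simp: hom_def)
  subgoal using plus_comp by (auto simp: hom_def)
  subgoal using zero_plus by (auto simp: hom_def)
  subgoal using zero_plus[of f X A] plus_comm[of f X A "\<zero> X A"] by (auto simp: hom_def arrow_simps)
  subgoal using Pair_comp by (auto simp: hom_def)
  subgoal using Pi1_Pair by (auto simp: hom_def)
  subgoal using Pi2_Pair by (auto simp: hom_def)
  subgoal using Pair_unique[of A B "\<I> (A \<otimes> B)" "A \<otimes> B"] comp_Id[OF Pi1_hom] comp_Id[OF Pi2_hom]
    by (simp add: Id_hom arrow_simps)
  done

text \<open>These rules push the derivative inward through composites and pairings, so composites
  built from projections and pairings reach a normal form. D6, D7 and the additive half of D2 are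
  absent: they are invoked explicitly where a second derivative or a sum of directions
  occurs.\<close>

lemma D_simps:
  "\<lbrakk>f \<in> Ar C; g \<in> Ar C; Dom C f = Dom C g; Cod C f = Cod C g\<rbrakk> \<Longrightarrow> \<D> (f \<oplus> g) = \<D> f \<oplus> \<D> g"
  "\<lbrakk>A \<in> Ob C; B \<in> Ob C\<rbrakk> \<Longrightarrow> \<D> (\<zero> A B) = \<zero> (A \<otimes> A) B"
  "\<lbrakk>f \<in> Ar C; v \<in> Ar C; Cod C v = Dom C f; Dom C f = A; Dom C v = X\<rbrakk>
     \<Longrightarrow> \<D> f \<odot> \<langle>\<zero> X A, v\<rangle> = \<zero> X (Cod C f)"
  "A \<in> Ob C \<Longrightarrow> \<D> (\<I> A) = \<pi>\<^sub>1 A A"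
  "\<lbrakk>A \<in> Ob C; B \<in> Ob C\<rbrakk> \<Longrightarrow> \<D> (\<pi>\<^sub>1 A B) = \<pi>\<^sub>1 A B \<odot> \<pi>\<^sub>1 (A \<otimes> B) (A \<otimes> B)"
  "\<lbrakk>A \<in> Ob C; B \<in> Ob C\<rbrakk> \<Longrightarrow> \<D> (\<pi>\<^sub>2 A B) = \<pi>\<^sub>2 A B \<odot> \<pi>\<^sub>1 (A \<otimes> B) (A \<otimes> B)"
  "\<lbrakk>f \<in> Ar C; g \<in> Ar C; Dom C f = Dom C g\<rbrakk> \<Longrightarrow> \<D> \<langle>f, g\<rangle> = \<langle>\<D> f, \<D> g\<rangle>"
  "\<lbrakk>f \<in> Ar C; g \<in> Ar C; Dom C f = Cod C g\<rbrakk>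
    \<Longrightarrow> \<D> (f \<odot> g) = \<D> f \<odot> \<langle>\<D> g, g \<odot> \<pi>\<^sub>2 (Dom C g) (Dom C g)\<rangle>"
  subgoal using D1_plus by (simp add: hom_def)
  subgoal by (rule D1_zero)
  subgoal using D2_zero[of f A "Cod C f" v X] by (simp add: hom_def)
  subgoal by (rule D3_Id)
  subgoal by (rule D3_Pi1)
  subgoal by (rule D3_Pi2)
  subgoal using D4 by (simp add: hom_def)
  subgoal using D5 by (simp add: hom_def)
  done

lemmas cat_simps = arrow_simps comp_simps D_simps

section \<open>Additivity of pairings and linear maps, and currying\<close>

text \<open>Both sides have the same components, because the projections are additive; left
  additivity of composition alone would not give this.\<close>

lemma Pair_plus:
  assumes "f \<in> hom C X A" "f' \<in> hom C X A" "g \<in> hom C X B" "g' \<in> hom C X B"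
  shows "\<langle>f \<oplus> f', g \<oplus> g'\<rangle> = \<langle>f, g\<rangle> \<oplus> \<langle>f', g'\<rangle>"
proof -
  have ob: "X \<in> Ob C" "A \<in> Ob C" "B \<in> Ob C" using assms hom_Ob by blast+
  let ?h = "\<langle>f, g\<rangle> \<oplus> \<langle>f', g'\<rangle>"
  have "?h \<in> hom C X (A \<otimes> B)" using assms by (intro plus_hom Pair_hom)
  moreover have "\<pi>\<^sub>1 A B \<odot> ?h = f \<oplus> f'" "\<pi>\<^sub>2 A B \<odot> ?h = g \<oplus> g'"
    using Pi1_additive[of A B] Pi2_additive[of A B] assms ob
    by (simp_all add: additive_def cat_simps hom_def)
  ultimately show ?thesis using Pair_unique[OF ob(2,3), of ?h X] by simp
qed

text \<open>For linear \<open>f\<close>, composing with \<open>k\<close> is the derivative of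
  \<open>f\<close> in direction \<open>k\<close> at base point zero, and D2 makes that additive in
  the direction.\<close>

lemma linear_comp_plus:
  assumes "linear C f" "f \<in> hom C A B" "g \<in> hom C X A" "h \<in> hom C X A"
  shows "f \<odot> (g \<oplus> h) = f \<odot> g \<oplus> f \<odot> h"
proof -
  have ob: "X \<in> Ob C" "A \<in> Ob C" using assms hom_Ob by blast+
  have *: "f \<odot> k = \<D> f \<odot> \<langle>k, \<zero> X A\<rangle>" if "k \<in> hom C X A" for k
    using assms that ob by (simp add: linear_def hom_def cat_simps)
  show ?thesis
    using *[OF assms(3)] *[OF assms(4)] *[OF plus_hom[OF assms(3,4)]]
      D2_plus[OF assms(2-4) zero_hom[OF ob]] by simp
qed

lemma linear_comp_zero:
  assumes "linear C f" "f \<in> hom C A B" "X \<in> Ob C"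
  shows "f \<odot> \<zero> X A = \<zero> X B"
proof -
  have ob: "A \<in> Ob C" using assms hom_Ob by blast
  have "f \<odot> \<zero> X A = \<D> f \<odot> \<langle>\<zero> X A, \<zero> X A\<rangle>"
    using assms ob by (simp add: linear_def hom_def comp_simps arrow_simps)
  also have "\<dots> = \<zero> X B" using assms ob by (simp add: hom_def cat_simps)
  finally show ?thesis .
qed

lemma uncur_eq:
  assumes "h \<in> hom C X [A \<Rightarrow> B]" "A \<in> Ob C"
  shows "\<Lambda>\<^sup>- A B h = ev A B \<odot> \<langle>h \<odot> \<pi>\<^sub>1 X A, \<pi>\<^sub>2 X A\<rangle>"
  using assms by (auto simp: uncur_def cross_def hom_def cat_simps)

text \<open>The beta law at arbitrary arguments: \<open>Ev_Cur\<close> precomposed with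
  \<open>\<langle>a, b\<rangle>\<close>.\<close>

lemma Ev_Cur_Pair:
  assumes "f \<in> hom C (X \<otimes> A) B" "a \<in> hom C Y X" "b \<in> hom C Y A"
  shows "ev A B \<odot> \<langle>\<Lambda> X A f \<odot> a, b\<rangle> = f \<odot> \<langle>a, b\<rangle>"
proof -
  have ob: "X \<in> Ob C" "A \<in> Ob C" "B \<in> Ob C" using assms hom_Ob by blast+
  have "f \<odot> \<langle>a, b\<rangle> = (ev A B \<odot> (\<Lambda> X A f \<boxtimes> \<I> A)) \<odot> \<langle>a, b\<rangle>"
    using Ev_Cur[OF ob(1,2) assms(1)] by simp
  also have "\<dots> = ev A B \<odot> \<langle>\<Lambda> X A f \<odot> a, b\<rangle>"
    using assms ob by (simp add: cross_def hom_def cat_simps)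
  finally show ?thesis by simp
qed

text \<open>Naturality of currying in the context. Both sides have the same uncurrying, so
  uniqueness of currying identifies them.\<close>

lemma Cur_comp:
  assumes "f \<in> hom C (X \<otimes> A) B" "h \<in> hom C Y X" "X \<in> Ob C" "A \<in> Ob C"
  shows "\<Lambda> X A f \<odot> h = \<Lambda> Y A (f \<odot> \<langle>h \<odot> \<pi>\<^sub>1 Y A, \<pi>\<^sub>2 Y A\<rangle>)"
proof -
  have ob: "Y \<in> Ob C" "B \<in> Ob C" using assms hom_Ob by blast+
  have h: "\<Lambda> X A f \<odot> h \<in> hom C Y [A \<Rightarrow> B]" using assms by (intro comp_hom[OF Cur_hom])
  have "ev A B \<odot> ((\<Lambda> X A f \<odot> h) \<boxtimes> \<I> A) = ev A B \<odot> \<langle>\<Lambda> X A f \<odot> (h \<odot> \<pi>\<^sub>1 Y A), \<pi>\<^sub>2 Y A\<rangle>"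
    using assms ob by (simp add: cross_def hom_def cat_simps)
  also have "\<dots> = f \<odot> \<langle>h \<odot> \<pi>\<^sub>1 Y A, \<pi>\<^sub>2 Y A\<rangle>"
    using assms ob by (intro Ev_Cur_Pair) (auto simp: hom_def cat_simps)
  finally show ?thesis using Cur_unique[OF assms(4) ob(2) h] by simp
qed

section \<open>Derivatives of evaluation and currying\<close>

text \<open>Evaluation is linear in the function: apply \<open>D_Cur\<close> to \<open>\<Lambda>(ev) = Id\<close>.\<close>

lemma D_Ev_left:
  assumes "a \<in> hom C X [A \<Rightarrow> B]" "b \<in> hom C X [A \<Rightarrow> B]" "c \<in> hom C X A" "B \<in> Ob C"
  shows "\<D> (ev A B) \<odot> \<langle>\<langle>a, \<zero> X A\<rangle>, \<langle>b, c\<rangle>\<rangle> = ev A B \<odot> \<langle>a, c\<rangle>"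
proof -
  have ob: "X \<in> Ob C" "A \<in> Ob C" "[A \<Rightarrow> B] \<in> Ob C" using assms hom_Ob by blast+
  let ?E = "[A \<Rightarrow> B]"
  let ?g = "\<D> (ev A B) \<odot> \<langle>\<pi>\<^sub>1 ?E ?E \<boxtimes> \<zero> A A, \<pi>\<^sub>2 ?E ?E \<boxtimes> \<I> A\<rangle>"
  have "\<Lambda> ?E A (ev A B) = \<I> ?E"
    using Cur_unique[OF ob(2) assms(4) Id_hom[OF ob(3)]] ob assms(4)
    by (simp add: cross_def cat_simps)
  then have *: "\<Lambda> (?E \<otimes> ?E) A ?g = \<pi>\<^sub>1 ?E ?E"
    using D_Cur[OF ob(3,2) Ev_hom[OF ob(2) assms(4)]] D3_Id[OF ob(3)] by simp
  have g: "?g \<in> hom C ((?E \<otimes> ?E) \<otimes> A) B"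
    using ob assms(4) by (simp add: cross_def hom_def cat_simps)
  have ab: "\<langle>a, b\<rangle> \<in> hom C X (?E \<otimes> ?E)" using assms by (intro Pair_hom)
  \<comment> \<open>The arrow \<open>?g\<close> is evaluated at the same point in two ways:
    directly, and by the beta law, where its currying, the first projection, selects
    \<open>a\<close>.\<close>
  have "?g \<odot> \<langle>\<langle>a, b\<rangle>, c\<rangle> = \<D> (ev A B) \<odot> \<langle>\<langle>a, \<zero> X A\<rangle>, \<langle>b, c\<rangle>\<rangle>"
    using ob assms by (simp add: cross_def hom_def cat_simps)
  moreover have "?g \<odot> \<langle>\<langle>a, b\<rangle>, c\<rangle> = ev A B \<odot> \<langle>a, c\<rangle>"
    using Ev_Cur_Pair[OF g ab assms(3)] ob assms unfolding * by (simp add: hom_def cat_simps)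
  ultimately show ?thesis by simp
qed

text \<open>\<open>D_Cur\<close> holds the curried coordinate fixed, which is the zero in the new
  direction; naturality of currying then carries \<open>\<langle>d, \<I> X\<rangle>\<close> under
  \<open>\<Lambda>\<close>.\<close>

lemma D_Cur_along:
  assumes "f \<in> hom C (X \<otimes> A) B" "d \<in> hom C X X" "A \<in> Ob C"
  shows "\<D> (\<Lambda> X A f) \<odot> \<langle>d, \<I> X\<rangle> =
    \<Lambda> X A (\<D> f \<odot> \<langle>\<langle>d \<odot> \<pi>\<^sub>1 X A, \<zero> (X \<otimes> A) A\<rangle>, \<I> (X \<otimes> A)\<rangle>)"
proof -
  have ob: "X \<in> Ob C" "B \<in> Ob C" using assms hom_Ob by blast+
  let ?g = "\<D> f \<odot> \<langle>\<pi>\<^sub>1 X X \<boxtimes> \<zero> A A, \<pi>\<^sub>2 X X \<boxtimes> \<I> A\<rangle>"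
  have g: "?g \<in> hom C ((X \<otimes> X) \<otimes> A) B"
    using ob assms by (simp add: cross_def hom_def cat_simps)
  have d: "\<langle>d, \<I> X\<rangle> \<in> hom C X (X \<otimes> X)" using ob assms by (intro Pair_hom Id_hom)
  have "?g \<odot> \<langle>\<langle>d, \<I> X\<rangle> \<odot> \<pi>\<^sub>1 X A, \<pi>\<^sub>2 X A\<rangle> =
     \<D> f \<odot> \<langle>\<langle>d \<odot> \<pi>\<^sub>1 X A, \<zero> (X \<otimes> A) A\<rangle>, \<I> (X \<otimes> A)\<rangle>"
    using ob assms by (simp add: cross_def hom_def cat_simps)
  then show ?thesis
    using Cur_comp[OF g d _ assms(3)] D_Cur[OF ob(1) assms(3,1)] ob by (simp add: cat_simps)
qed

section \<open>Bilinearity of \<open>\<star>\<close> and its Leibniz rule\<close>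

lemma star_plus_left:
  assumes "f \<in> hom C (X \<otimes> A) B" "f' \<in> hom C (X \<otimes> A) B" "g \<in> hom C X A"
  shows "(f \<oplus> f') \<star> g = f \<star> g \<oplus> f' \<star> g"
  using assms hom_Ob[OF assms(3)] star_eq[OF assms(3)] by (simp add: hom_def cat_simps)

lemma star_zero_left:
  assumes "g \<in> hom C X A" "B \<in> Ob C"
  shows "\<zero> (X \<otimes> A) B \<star> g = \<zero> (X \<otimes> A) B"
  using assms hom_Ob[OF assms(1)] star_eq[OF assms(1)] by (simp add: hom_def cat_simps)

text \<open>The arrow \<open>g\<close> enters \<open>f \<star> g\<close> only through the direction
  of differentiation, so the claim is D2 once the direction is split as a sum.\<close>

lemma star_plus_right:
  assumes "f \<in> hom C (X \<otimes> A) B" "g \<in> hom C X A" "g' \<in> hom C X A"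
  shows "f \<star> (g \<oplus> g') = f \<star> g \<oplus> f \<star> g'"
proof -
  have ob: "X \<in> Ob C" "A \<in> Ob C" using assms hom_Ob by blast+
  let ?P = "X \<otimes> A" and ?z = "\<zero> (X \<otimes> A) X"
  have P: "?P \<in> Ob C" using ob by (rule Prod_Ob)
  have z: "?z \<in> hom C ?P X" using P ob by (intro zero_hom)
  have k: "k \<odot> \<pi>\<^sub>1 X A \<in> hom C ?P A" if "k \<in> hom C X A" for k
    using that ob comp_hom Pi1_hom by blast
  have "\<langle>?z, (g \<oplus> g') \<odot> \<pi>\<^sub>1 X A\<rangle> = \<langle>?z, g \<odot> \<pi>\<^sub>1 X A\<rangle> \<oplus> \<langle>?z, g' \<odot> \<pi>\<^sub>1 X A\<rangle>"
    using Pair_plus[OF z z k[OF assms(2)] k[OF assms(3)]] plus_comp[OF assms(2,3) Pi1_hom[OF ob]]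
      zero_plus[OF z] by simp
  then show ?thesis
    using star_eq[OF plus_hom[OF assms(2,3)]] star_eq[OF assms(2)] star_eq[OF assms(3)]
      D2_plus[OF assms(1) Pair_hom[OF z k[OF assms(2)]] Pair_hom[OF z k[OF assms(3)]] Id_hom[OF P]]
    by simp
qed

lemma star_zero_right:
  assumes "f \<in> hom C (X \<otimes> A) B" "X \<in> Ob C" "A \<in> Ob C"
  shows "f \<star> \<zero> X A = \<zero> (X \<otimes> A) B"
proof -
  have P: "X \<otimes> A \<in> Ob C" using assms by (intro Prod_Ob)
  have "f \<star> \<zero> X A = \<D> f \<odot> \<langle>\<langle>\<zero> (X \<otimes> A) X, \<zero> (X \<otimes> A) A\<rangle>, \<I> (X \<otimes> A)\<rangle>"
    using star_eq[OF zero_hom[OF assms(2,3)]] zero_comp[OF assms(3) Pi1_hom[OF assms(2,3)]] by simp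
  then show ?thesis
    using Pair_zero[OF P assms(2,3)] D2_zero[OF assms(1) Id_hom[OF P]] by simp
qed

text \<open>The context enters \<open>f \<star> g\<close> through \<open>f\<close> and through
  \<open>g\<close>, and each dependence contributes one summand.\<close>

lemma D_star_along:
  assumes f: "f \<in> hom C (X \<otimes> A) B" and g: "g \<in> hom C X A" and d: "d \<in> hom C X X"
  defines "e \<equiv> \<langle>\<langle>d \<odot> \<pi>\<^sub>1 X A, \<zero> (X \<otimes> A) A\<rangle>, \<I> (X \<otimes> A)\<rangle>"
  shows "\<D> (f \<star> g) \<odot> e = (\<D> f \<odot> e) \<star> g \<oplus> f \<star> (\<D> g \<odot> \<langle>d, \<I> X\<rangle>)"
proof -
  have ob: "X \<in> Ob C" "A \<in> Ob C" "B \<in> Ob C" using f g hom_Ob by blast+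
  define P where "P = X \<otimes> A"
  have P: "P \<in> Ob C" unfolding P_def using ob by (intro Prod_Ob)
  define h where "h = \<D> g \<odot> \<langle>d, \<I> X\<rangle>"
  \<comment> \<open>On \<open>P\<close>, \<open>\<delta>\<close> is the outer direction
    \<open>d\<close> with the bound coordinate fixed, \<open>\<gamma>\<close> is the direction in
    which \<open>\<star> g\<close> differentiates, and \<open>\<eta>\<close> is the derivative of
    \<open>\<gamma>\<close> along \<open>\<delta>\<close>.\<close>
  define \<delta> where "\<delta> = \<langle>d \<odot> \<pi>\<^sub>1 X A, \<zero> P A\<rangle>"
  define \<gamma> where "\<gamma> = \<langle>\<zero> P X, g \<odot> \<pi>\<^sub>1 X A\<rangle>"
  define \<eta> where "\<eta> = \<langle>\<zero> P X, h \<odot> \<pi>\<^sub>1 X A\<rangle>"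
  have h: "h \<in> hom C X A" unfolding h_def using ob g d by (simp add: hom_def cat_simps)
  have homs: "\<delta> \<in> hom C P P" "\<gamma> \<in> hom C P P" "\<eta> \<in> hom C P P" "\<I> P \<in> hom C P P"
    unfolding \<delta>_def \<gamma>_def \<eta>_def P_def using ob g d h by (simp_all add: hom_def cat_simps)
  note z = zero_hom[OF P P]
  have Df: "\<D> f \<in> hom C (P \<otimes> P) B" unfolding P_def by (rule D_hom[OF f])
  have "\<D> (f \<star> g) \<odot> e = \<D> (\<D> f) \<odot> \<langle>\<langle>\<eta>, \<delta>\<rangle>, \<langle>\<gamma>, \<I> P\<rangle>\<rangle>"
    unfolding star_eq[OF g] e_def \<eta>_def \<delta>_def \<gamma>_def h_def P_def
    using ob f g d by (simp add: hom_def cat_simps)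
  also have "\<langle>\<eta>, \<delta>\<rangle> = \<langle>\<zero> P P, \<delta>\<rangle> \<oplus> \<langle>\<eta>, \<zero> P P\<rangle>"
    using Pair_plus[OF z homs(3) homs(1) z] homs P by (simp add: hom_def cat_simps)
  also have "\<D> (\<D> f) \<odot> \<langle>\<dots>, \<langle>\<gamma>, \<I> P\<rangle>\<rangle> =
      \<D> (\<D> f) \<odot> \<langle>\<langle>\<zero> P P, \<delta>\<rangle>, \<langle>\<gamma>, \<I> P\<rangle>\<rangle> \<oplus> \<D> (\<D> f) \<odot> \<langle>\<langle>\<eta>, \<zero> P P\<rangle>, \<langle>\<gamma>, \<I> P\<rangle>\<rangle>"
    by (rule D2_plus[OF Df Pair_hom[OF z homs(1)] Pair_hom[OF homs(3) z] Pair_hom[OF homs(2,4)]])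
  \<comment> \<open>Varying only the inner direction gives back a first derivative, by D6. In the
    other summand D7 exchanges \<open>\<delta>\<close> and \<open>\<gamma>\<close>, so that
    differentiation along \<open>\<delta>\<close> comes first and \<open>\<star> g\<close>
    last.\<close>
  also have "\<D> (\<D> f) \<odot> \<langle>\<langle>\<eta>, \<zero> P P\<rangle>, \<langle>\<gamma>, \<I> P\<rangle>\<rangle> = \<D> f \<odot> \<langle>\<eta>, \<I> P\<rangle>"
    using f homs by (intro D6) (auto simp: P_def)
  also have "\<dots> = f \<star> h"
    unfolding star_eq[OF h] \<eta>_def P_def ..
  also have "\<D> (\<D> f) \<odot> \<langle>\<langle>\<zero> P P, \<delta>\<rangle>, \<langle>\<gamma>, \<I> P\<rangle>\<rangle> = \<D> (\<D> f) \<odot> \<langle>\<langle>\<zero> P P, \<gamma>\<rangle>, \<langle>\<delta>, \<I> P\<rangle>\<rangle>"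
    using f homs by (intro D7) (auto simp: P_def)
  also have "\<dots> = (\<D> f \<odot> e) \<star> g"
    \<comment> \<open>\<open>d \<circ> \<pi>\<^sub>1\<close> does not vary in the direction \<open>\<gamma>\<close>.\<close>
    unfolding star_eq[OF g] e_def \<delta>_def \<gamma>_def P_def
    using ob f g d Pair_zero[of "X \<otimes> A" X A] by (simp add: hom_def cat_simps)
  finally show ?thesis unfolding h_def .
qed

section \<open>Additivity of evaluation, and derivatives of application\<close>

text \<open>By \<open>D_Ev_left\<close> each evaluation is a derivative of \<open>ev\<close> in a
  direction that changes only the function, and D2 adds directions. The function component of the
  base point is arbitrary there, so \<open>f\<close> serves for all three terms.\<close>

lemma Ev_plus:
  assumes "f \<in> hom C X [A \<Rightarrow> B]" "f' \<in> hom C X [A \<Rightarrow> B]" "b \<in> hom C X A" "B \<in> Ob C"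
  shows "ev A B \<odot> \<langle>f \<oplus> f', b\<rangle> = ev A B \<odot> \<langle>f, b\<rangle> \<oplus> ev A B \<odot> \<langle>f', b\<rangle>"
proof -
  have ob: "X \<in> Ob C" "A \<in> Ob C" using assms hom_Ob by blast+
  note z = zero_hom[OF ob]
  have "\<langle>f \<oplus> f', \<zero> X A\<rangle> = \<langle>f, \<zero> X A\<rangle> \<oplus> \<langle>f', \<zero> X A\<rangle>"
    using Pair_plus[OF assms(1,2) z z] zero_plus[OF z] by simp
  then show ?thesis
    using D_Ev_left[OF assms(1,1,3,4)] D_Ev_left[OF assms(2,1,3,4)]
      D_Ev_left[OF plus_hom[OF assms(1,2)] assms(1,3,4)]
      D2_plus[OF Ev_hom[OF ob(2) assms(4)] Pair_hom[OF assms(1) z] Pair_hom[OF assms(2) z]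
        Pair_hom[OF assms(1,3)]] by simp
qed

lemma Ev_zero:
  assumes "b \<in> hom C X A" "B \<in> Ob C"
  shows "ev A B \<odot> \<langle>\<zero> X [A \<Rightarrow> B], b\<rangle> = \<zero> X B"
proof -
  have ob: "X \<in> Ob C" "A \<in> Ob C" "[A \<Rightarrow> B] \<in> Ob C" using assms hom_Ob Exp_Ob by blast+
  note z = zero_hom[OF ob(1,3)]
  show ?thesis
    using D_Ev_left[OF z z assms] Pair_zero[OF ob(1,3,2)]
      D2_zero[OF Ev_hom[OF ob(2) assms(2)] Pair_hom[OF z assms(1)]] by simp
qed

lemma uncur_plus:
  assumes "h \<in> hom C X [A \<Rightarrow> B]" "h' \<in> hom C X [A \<Rightarrow> B]" "A \<in> Ob C" "B \<in> Ob C"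
  shows "\<Lambda>\<^sup>- A B (h \<oplus> h') = \<Lambda>\<^sup>- A B h \<oplus> \<Lambda>\<^sup>- A B h'"
proof -
  have X: "X \<in> Ob C" using assms hom_Ob by blast
  note p = Pi1_hom[OF X assms(3)] Pi2_hom[OF X assms(3)]
  show ?thesis
    using Ev_plus[OF comp_hom[OF assms(1) p(1)] comp_hom[OF assms(2) p(1)] p(2) assms(4)]
      plus_comp[OF assms(1,2) p(1)] uncur_eq[OF plus_hom[OF assms(1,2)] assms(3)]
      uncur_eq[OF assms(1,3)] uncur_eq[OF assms(2,3)] by simp
qed

lemma uncur_zero:
  assumes "X \<in> Ob C" "A \<in> Ob C" "B \<in> Ob C"
  shows "\<Lambda>\<^sup>- A B (\<zero> X [A \<Rightarrow> B]) = \<zero> (X \<otimes> A) B"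
  using assms uncur_eq[of "\<zero> X [A \<Rightarrow> B]" X A B] Ev_zero[of "\<pi>\<^sub>2 X A" "X \<otimes> A" A B]
  by (simp add: hom_def cat_simps)

lemma linear_D_comp_along:
  assumes "linear C l" "l \<in> hom C A B" "f \<in> hom C X A" "d \<in> hom C X X"
  shows "\<D> (l \<odot> f) \<odot> \<langle>d, \<I> X\<rangle> = l \<odot> (\<D> f \<odot> \<langle>d, \<I> X\<rangle>)"
  using assms hom_Ob[OF assms(2)] hom_Ob[OF assms(3)] by (auto simp: hom_def cat_simps linear_def)

text \<open>The direction leaves the bound coordinate fixed, so only the function component of
  \<open>ev\<close> varies and \<open>D_Ev_left\<close> removes the derivative of
  \<open>ev\<close>.\<close>

lemma D_uncur_along:
  assumes "h \<in> hom C X [A \<Rightarrow> B]" "d \<in> hom C X X" "A \<in> Ob C" "B \<in> Ob C"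
  shows "\<D> (\<Lambda>\<^sup>- A B h) \<odot> \<langle>\<langle>d \<odot> \<pi>\<^sub>1 X A, \<zero> (X \<otimes> A) A\<rangle>, \<I> (X \<otimes> A)\<rangle> =
    \<Lambda>\<^sup>- A B (\<D> h \<odot> \<langle>d, \<I> X\<rangle>)"
proof -
  have X: "X \<in> Ob C" using assms hom_Ob by blast
  define Dh where "Dh = \<D> h \<odot> \<langle>d \<odot> \<pi>\<^sub>1 X A, \<pi>\<^sub>1 X A\<rangle>"
  have "\<D> (\<Lambda>\<^sup>- A B h) \<odot> \<langle>\<langle>d \<odot> \<pi>\<^sub>1 X A, \<zero> (X \<otimes> A) A\<rangle>, \<I> (X \<otimes> A)\<rangle> =
      \<D> (ev A B) \<odot> \<langle>\<langle>Dh, \<zero> (X \<otimes> A) A\<rangle>, \<langle>h \<odot> \<pi>\<^sub>1 X A, \<pi>\<^sub>2 X A\<rangle>\<rangle>"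
    using assms X unfolding uncur_eq[OF assms(1,3)] Dh_def by (simp add: hom_def cat_simps)
  also have "\<dots> = ev A B \<odot> \<langle>Dh, \<pi>\<^sub>2 X A\<rangle>"
    using assms X unfolding Dh_def by (intro D_Ev_left) (auto simp: hom_def cat_simps)
  also have "\<dots> = \<Lambda>\<^sup>- A B (\<D> h \<odot> \<langle>d, \<I> X\<rangle>)"
    using assms X uncur_eq[of "\<D> h \<odot> \<langle>d, \<I> X\<rangle>" X A B] unfolding Dh_def
    by (simp add: hom_def cat_simps)
  finally show ?thesis .
qed

text \<open>Differentiating \<open>ev\<close> in its argument alone is what \<open>\<star>\<close>
  does to an uncurried map. This connects the chain rule with the summand of differential
  substitution in which a linear application is applied to the old argument.\<close>

lemma uncur_star_Pair:
  assumes "h \<in> hom C X [A \<Rightarrow> B]" "g \<in> hom C X A" "v \<in> hom C X A" "B \<in> Ob C"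
  shows "(\<Lambda>\<^sup>- A B h \<star> g) \<odot> \<langle>\<I> X, v\<rangle> =
    \<D> (ev A B) \<odot> \<langle>\<langle>\<zero> X [A \<Rightarrow> B], g\<rangle>, \<langle>h, v\<rangle>\<rangle>"
proof -
  have ob: "X \<in> Ob C" "A \<in> Ob C" using assms hom_Ob by blast+
  show ?thesis unfolding star_eq[OF assms(2)] uncur_eq[OF assms(1) ob(2)]
    using assms ob by (simp add: hom_def cat_simps)
qed

text \<open>The direction splits into a function part and an argument part, matching the two
  summands of differential substitution into an application.\<close>

lemma D_Ev_Pair_along:
  assumes "h \<in> hom C X [A \<Rightarrow> B]" "v \<in> hom C X A" "d \<in> hom C X X" "B \<in> Ob C"
  shows "\<D> (ev A B \<odot> \<langle>h, v\<rangle>) \<odot> \<langle>d, \<I> X\<rangle> =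
    ev A B \<odot> \<langle>\<D> h \<odot> \<langle>d, \<I> X\<rangle>, v\<rangle> \<oplus> (\<Lambda>\<^sup>- A B h \<star> (\<D> v \<odot> \<langle>d, \<I> X\<rangle>)) \<odot> \<langle>\<I> X, v\<rangle>"
proof -
  have ob: "X \<in> Ob C" "A \<in> Ob C" "[A \<Rightarrow> B] \<in> Ob C" using assms hom_Ob by blast+
  define a where "a = \<D> h \<odot> \<langle>d, \<I> X\<rangle>"
  define b where "b = \<D> v \<odot> \<langle>d, \<I> X\<rangle>"
  have a: "a \<in> hom C X [A \<Rightarrow> B]" and b: "b \<in> hom C X A"
    unfolding a_def b_def using assms ob by (simp_all add: hom_def cat_simps)
  note z = zero_hom[OF ob(1,3)] zero_hom[OF ob(1,2)]
  have "\<D> (ev A B \<odot> \<langle>h, v\<rangle>) \<odot> \<langle>d, \<I> X\<rangle> = \<D> (ev A B) \<odot> \<langle>\<langle>a, b\<rangle>, \<langle>h, v\<rangle>\<rangle>"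
    unfolding a_def b_def using assms ob by (simp add: hom_def cat_simps)
  also have "\<langle>a, b\<rangle> = \<langle>a, \<zero> X A\<rangle> \<oplus> \<langle>\<zero> X [A \<Rightarrow> B], b\<rangle>"
    using Pair_plus[OF a z b] a b ob by (simp add: hom_def cat_simps)
  also have "\<D> (ev A B) \<odot> \<langle>\<dots>, \<langle>h, v\<rangle>\<rangle> =
      \<D> (ev A B) \<odot> \<langle>\<langle>a, \<zero> X A\<rangle>, \<langle>h, v\<rangle>\<rangle> \<oplus> \<D> (ev A B) \<odot> \<langle>\<langle>\<zero> X [A \<Rightarrow> B], b\<rangle>, \<langle>h, v\<rangle>\<rangle>"
    by (rule D2_plus[OF Ev_hom[OF ob(2) assms(4)] Pair_hom[OF a z(2)] Pair_hom[OF z(1) b]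
          Pair_hom[OF assms(1,2)]])
  finally show ?thesis
    using D_Ev_left[OF a assms(1,2,4)] uncur_star_Pair[OF assms(1) b assms(2,4)]
    unfolding a_def b_def by simp
qed

section \<open>Stability under change of context\<close>

text \<open>On the left the chain rule differentiates \<open>h\<close> in direction zero, because
  \<open>\<star>\<close> does not move the context; that contribution vanishes by D2.\<close>

lemma star_comp_Pair:
  assumes "f \<in> hom C (X \<otimes> A) B" "g \<in> hom C X A" "h \<in> hom C Y X"
  shows "(f \<odot> \<langle>h \<odot> \<pi>\<^sub>1 Y A, \<pi>\<^sub>2 Y A\<rangle>) \<star> (g \<odot> h) = (f \<star> g) \<odot> \<langle>h \<odot> \<pi>\<^sub>1 Y A, \<pi>\<^sub>2 Y A\<rangle>"
proof -
  have ob: "X \<in> Ob C" "A \<in> Ob C" "Y \<in> Ob C" using assms hom_Ob by blast+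
  show ?thesis unfolding star_eq[OF assms(2)] star_eq[OF comp_hom[OF assms(2,3)]]
    using assms ob by (simp add: hom_def cat_simps)
qed

lemma uncur_comp:
  assumes "k \<in> hom C X [A \<Rightarrow> B]" "h \<in> hom C Y X" "A \<in> Ob C" "B \<in> Ob C"
  shows "\<Lambda>\<^sup>- A B (k \<odot> h) = \<Lambda>\<^sup>- A B k \<odot> \<langle>h \<odot> \<pi>\<^sub>1 Y A, \<pi>\<^sub>2 Y A\<rangle>"
proof -
  have ob: "X \<in> Ob C" "Y \<in> Ob C" using assms hom_Ob by blast+
  show ?thesis unfolding uncur_eq[OF assms(1,3)] uncur_eq[OF comp_hom[OF assms(1,2)] assms(3)]
    using assms ob by (simp add: hom_def cat_simps)
qed

lemma sum_hom_append:
  assumes "A \<in> Ob C" "B \<in> Ob C" "set fs \<subseteq> hom C A B" "set gs \<subseteq> hom C A B"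
  shows "sum_hom C A B (fs @ gs) = sum_hom C A B fs \<oplus> sum_hom C A B gs"
  using assms(3)
proof (induction fs)
  case Nil
  then show ?case using zero_plus[OF sum_hom_hom[OF assms(1,2,4)]] by simp
next
  case (Cons f fs)
  then show ?case
    using plus_assoc[of f A B "sum_hom C A B fs" "sum_hom C A B gs"] assms by (simp add: sum_hom_hom)
qed

text \<open>This makes the derivative of a variable along \<open>d\<close> the corresponding
  component of \<open>d\<close>.\<close>

lemma proj_linear: "U \<in> Ob C \<Longrightarrow> linear C (proj C U xs v)"
proof (induction xs rule: rev_induct)
  case Nil
  then show ?case by (simp add: linear_def cat_simps One_Ob)
next
  case (snoc x xs)
  then show ?case
    using proj_hom[of U xs v] ctx_Ob[of U xs] by (auto simp: linear_def hom_def cat_simps)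
qed

section \<open>Linearity of the term constructors in a linear reflexive object\<close>

context
  fixes U \<A> lam
  assumes lro: "linear_reflexive_object C U \<A> lam"
begin

abbreviation sint where "sint \<equiv> sinterp C U \<A> lam"
abbreviation rint where "rint \<equiv> rinterp C U \<A> lam"
abbreviation cx where "cx \<equiv> ctx C U"

text \<open>Together with \<open>dif_hom\<close> this turns the semantic clauses into operations on
  arrows, for which additivity can be stated.\<close>

definition app_hom :: "'b \<Rightarrow> 'b \<Rightarrow> 'b" where
  "app_hom a b = ev U U \<odot> \<langle>\<A> \<odot> a, b\<rangle>"

definition dif_hom :: "'a \<Rightarrow> 'b \<Rightarrow> 'b \<Rightarrow> 'b" where
  "dif_hom X a b = lam \<odot> \<Lambda> X U (\<Lambda>\<^sup>- U U (\<A> \<odot> a) \<star> b)"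

lemma lro_linear: "linear C \<A>" "linear C lam"
  using lro by (auto simp: linear_reflexive_object_def)

lemmas lro_homs = lroD[OF lro]

lemma uncur_app_hom: "a \<in> hom C X U \<Longrightarrow> \<Lambda>\<^sup>- U U (\<A> \<odot> a) \<in> hom C (X \<otimes> U) U"
  by (intro uncur_hom comp_hom[OF lro_homs(2)] lro_homs(1))

lemma app_hom_plus:
  assumes "a \<in> hom C X U" "a' \<in> hom C X U" "b \<in> hom C X U"
  shows "app_hom (a \<oplus> a') b = app_hom a b \<oplus> app_hom a' b"
  unfolding app_hom_def linear_comp_plus[OF lro_linear(1) lro_homs(2) assms(1,2)]
  using Ev_plus assms comp_hom[OF lro_homs(2)] lro_homs(1) by blast

lemma app_hom_zero:
  assumes "b \<in> hom C X U"
  shows "app_hom (\<zero> X U) b = \<zero> X U"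
  unfolding app_hom_def linear_comp_zero[OF lro_linear(1) lro_homs(2) hom_Ob(1)[OF assms]]
  by (rule Ev_zero[OF assms lro_homs(1)])

lemma lam_Cur_plus:
  assumes "f \<in> hom C (X \<otimes> U) U" "g \<in> hom C (X \<otimes> U) U" "X \<in> Ob C"
  shows "lam \<odot> \<Lambda> X U (f \<oplus> g) = lam \<odot> \<Lambda> X U f \<oplus> lam \<odot> \<Lambda> X U g"
  using Cur_plus[OF assms(3) lro_homs(1) assms(1,2)]
    linear_comp_plus[OF lro_linear(2) lro_homs(3) Cur_hom[OF assms(3) lro_homs(1) assms(1)]
      Cur_hom[OF assms(3) lro_homs(1) assms(2)]] by simp

lemma lam_Cur_zero:
  "X \<in> Ob C \<Longrightarrow> lam \<odot> \<Lambda> X U (\<zero> (X \<otimes> U) U) = \<zero> X U"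
  using Cur_zero[OF _ lro_homs(1,1)] linear_comp_zero[OF lro_linear(2) lro_homs(3)] by simp

lemma dif_hom_plus_left:
  assumes "a \<in> hom C X U" "a' \<in> hom C X U" "b \<in> hom C X U"
  shows "dif_hom X (a \<oplus> a') b = dif_hom X a b \<oplus> dif_hom X a' b"
  unfolding dif_hom_def linear_comp_plus[OF lro_linear(1) lro_homs(2) assms(1,2)]
    uncur_plus[OF comp_hom[OF lro_homs(2) assms(1)] comp_hom[OF lro_homs(2) assms(2)] lro_homs(1,1)]
    star_plus_left[OF uncur_app_hom[OF assms(1)] uncur_app_hom[OF assms(2)] assms(3)]
  using assms hom_Ob by (intro lam_Cur_plus star_hom uncur_app_hom)

lemma dif_hom_zero_left:
  assumes "b \<in> hom C X U"
  shows "dif_hom X (\<zero> X U) b = \<zero> X U"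
proof -
  have X: "X \<in> Ob C" using hom_Ob[OF assms] by blast
  show ?thesis unfolding dif_hom_def linear_comp_zero[OF lro_linear(1) lro_homs(2) X]
    using uncur_zero[OF X lro_homs(1,1)] star_zero_left[OF assms lro_homs(1)] lam_Cur_zero[OF X]
    by simp
qed

lemma dif_hom_plus_right:
  assumes "a \<in> hom C X U" "b \<in> hom C X U" "b' \<in> hom C X U"
  shows "dif_hom X a (b \<oplus> b') = dif_hom X a b \<oplus> dif_hom X a b'"
  unfolding dif_hom_def star_plus_right[OF uncur_app_hom[OF assms(1)] assms(2,3)]
  using assms hom_Ob by (intro lam_Cur_plus star_hom uncur_app_hom)

lemma dif_hom_zero_right:
  assumes "a \<in> hom C X U"
  shows "dif_hom X a (\<zero> X U) = \<zero> X U"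
  unfolding dif_hom_def
  using star_zero_right[OF uncur_app_hom[OF assms] hom_Ob[OF assms]] lam_Cur_zero hom_Ob[OF assms]
  by simp

section \<open>Interpretation of sums and of the extended constructors\<close>

lemma sinterp_app_dif:
  "sint xs (RApp s V) = app_hom (sint xs s) (rint xs V)"
  "sint xs (RDif s t) = dif_hom (cx xs) (sint xs s) (sint xs t)"
  by (simp_all add: app_hom_def dif_hom_def rinterp_def)

lemmas interp_homs = sinterp_hom[OF lro] rinterp_hom[OF lro] ctx_Ob[OF lro_homs(1)]

lemma sinterp_subset: "set (map (sint xs) S) \<subseteq> hom C (cx xs) U"
  using interp_homs by auto

lemma rinterp_append: "rint xs (S @ T) = rint xs S \<oplus> rint xs T"
  unfolding rinterp_def map_append
  by (intro sum_hom_append sinterp_subset interp_homs lro_homs)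

lemma rinterp_single: "rint xs [s] = sint xs s"
  using interp_homs lro_homs(1) unfolding rinterp_def by (auto simp: cat_simps hom_def)

text \<open>The common induction behind all extensions by linearity. Two contexts are allowed
  because abstraction shortens the context, and because the change-of-context lemmas use it
  too.\<close>

lemma rinterp_concat_map:
  assumes "\<And>f g. f \<in> hom C (cx xs) U \<Longrightarrow> g \<in> hom C (cx xs) U \<Longrightarrow> \<phi> (f \<oplus> g) = \<phi> f \<oplus> \<phi> g"
    and "\<phi> (\<zero> (cx xs) U) = \<zero> (cx ys) U"
    and "\<And>s. s \<in> set S \<Longrightarrow> rint ys (F s) = \<phi> (sint xs s)"
  shows "rint ys (concat (map F S)) = \<phi> (rint xs S)"
  using assms(3)
proof (induction S)
  case (Cons s S)
  then show ?case
    using assms(1)[of "sint xs s" "rint xs S"] interp_homs by (simp add: rinterp_append) (simp add: rinterp_def)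
qed (simp add: rinterp_def assms(2))

lemma rinterp_map:
  assumes "\<And>f g. f \<in> hom C (cx xs) U \<Longrightarrow> g \<in> hom C (cx xs) U \<Longrightarrow> \<phi> (f \<oplus> g) = \<phi> f \<oplus> \<phi> g"
    and "\<phi> (\<zero> (cx xs) U) = \<zero> (cx ys) U"
    and "\<And>s. s \<in> set S \<Longrightarrow> sint ys (F s) = \<phi> (sint xs s)"
  shows "rint ys (map F S) = \<phi> (rint xs S)"
  using rinterp_concat_map[OF assms(1,2), of S "\<lambda>s. [F s]"] assms(3) by (simp add: rinterp_single)

lemma rinterp_sum_lam:
  "rint xs (sum_lam z S) = lam \<odot> \<Lambda> (cx xs) U (rint (xs @ [z]) S)"
  unfolding sum_lam_def using lam_Cur_plus lam_Cur_zero interp_homs(3)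
  by (intro rinterp_map) auto

lemma rinterp_sum_app: "rint xs (sum_app S V) = app_hom (rint xs S) (rint xs V)"
  unfolding sum_app_def using app_hom_plus app_hom_zero interp_homs sinterp_app_dif(1)
  by (intro rinterp_map[where \<phi> = "\<lambda>a. app_hom a (rint xs V)"]) blast+

lemma rinterp_sum_dif: "rint xs (sum_dif S V) = dif_hom (cx xs) (rint xs S) (rint xs V)"
proof -
  have "rint xs (map (RDif s) V) = dif_hom (cx xs) (sint xs s) (rint xs V)" for s
    using dif_hom_plus_right dif_hom_zero_right interp_homs sinterp_app_dif(2)
    by (intro rinterp_map) blast+
  then show ?thesis unfolding sum_dif_def
    using dif_hom_plus_left dif_hom_zero_left interp_homs
    by (intro rinterp_concat_map[where \<phi> = "\<lambda>a. dif_hom (cx xs) a (rint xs V)"]) blast+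
qed

section \<open>Change of context and weakening\<close>

text \<open>Composition with \<open>h\<close> passes through each constructor, by
  \<open>Cur_comp\<close> for abstraction and also \<open>star_comp_Pair\<close> for
  \<open>RDif\<close>. Comparing only the free variables makes weakening by any name not free in the
  term an instance.\<close>

lemma sinterp_comp:
  assumes "h \<in> hom C (cx ys) (cx xs)" "\<And>v. v \<in> fv s \<Longrightarrow> proj C U ys v = proj C U xs v \<odot> h"
  shows "sint ys s = sint xs s \<odot> h"
  using assms
proof (induction s arbitrary: xs ys h)
  case (RVar x)
  then show ?case by simp
next
  case (RLam z s)
  let ?h = "\<langle>h \<odot> \<pi>\<^sub>1 (cx ys) U, \<pi>\<^sub>2 (cx ys) U\<rangle>"
  note h = RLam.prems(1)
  note p = Pi1_hom[OF interp_homs(3) lro_homs(1)] Pi2_hom[OF interp_homs(3) lro_homs(1)]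
  have "sint (ys @ [z]) s = sint (xs @ [z]) s \<odot> ?h"
  proof (rule RLam.IH)
    show "?h \<in> hom C (cx (ys @ [z])) (cx (xs @ [z]))"
      using Pair_hom[OF comp_hom[OF h p(1)] p(2)] by simp
    fix v assume "v \<in> fv s"
    then show "proj C U (ys @ [z]) v = proj C U (xs @ [z]) v \<odot> ?h"
      using RLam.prems interp_homs(3) lro_homs(1) proj_hom[of U xs v]
      by (auto simp: cat_simps hom_def)
  qed
  then show ?case
    using Cur_comp[OF _ h interp_homs(3) lro_homs(1), of "sint (xs @ [z]) s" U]
      interp_homs(1)[of "xs @ [z]" s]
      comp_assoc[OF lro_homs(3) Cur_hom[OF interp_homs(3) lro_homs(1)] h, of "sint (xs @ [z]) s"]
    by simp
next
  case (RApp s V)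
  note h = RApp.prems(1)
  have s: "sint ys s = sint xs s \<odot> h" using RApp.prems by (intro RApp.IH(1)) auto
  \<comment> \<open>The identity \<open>map\<close> puts the goal in the form of
    \<open>rinterp_map\<close>, with composition by \<open>h\<close> as the additive
    operation.\<close>
  have "rint ys (map (\<lambda>v. v) V) = rint xs V \<odot> h"
  proof (rule rinterp_map)
    show "sint ys v = sint xs v \<odot> h" if "v \<in> set V" for v
      using RApp.prems that by (intro RApp.IH(2)) auto
  qed (use h plus_comp zero_comp[OF lro_homs(1)] in blast)+
  then show ?case unfolding sinterp_app_dif app_hom_def
    using s h lro_homs(1,2) interp_homs(1)[of xs s] interp_homs(2)[of xs V]
    by (simp add: cat_simps hom_def)
next
  case (RDif s t)
  note h = RDif.prems(1)
  have st: "sint ys s = sint xs s \<odot> h" "sint ys t = sint xs t \<odot> h"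
    using RDif.prems by (intro RDif.IH; auto)+
  let ?s = "\<A> \<odot> sint xs s" and ?h = "\<langle>h \<odot> \<pi>\<^sub>1 (cx ys) U, \<pi>\<^sub>2 (cx ys) U\<rangle>"
  let ?f = "\<Lambda>\<^sup>- U U ?s"
  note f = uncur_app_hom[OF interp_homs(1), of xs s]
  note fs = star_hom[OF f interp_homs(1), of t]
  have "sint ys (RDif s t) = lam \<odot> \<Lambda> (cx ys) U ((?f \<star> sint xs t) \<odot> ?h)"
    unfolding sinterp_app_dif dif_hom_def st
    using comp_assoc[OF lro_homs(2) interp_homs(1) h] star_comp_Pair[OF f interp_homs(1) h]
      uncur_comp[OF comp_hom[OF lro_homs(2) interp_homs(1)] h lro_homs(1,1)] by simp
  also have "\<dots> = sint xs (RDif s t) \<odot> h"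
    unfolding sinterp_app_dif dif_hom_def
    using Cur_comp[OF fs h interp_homs(3) lro_homs(1)]
      comp_assoc[OF lro_homs(3) Cur_hom[OF interp_homs(3) lro_homs(1) fs] h] by simp
  finally show ?case .
qed

lemma rinterp_weaken:
  assumes "w \<notin> fvs T"
  shows "rint (xs @ [w]) T = rint xs T \<odot> \<pi>\<^sub>1 (cx xs) U"
proof -
  note p = Pi1_hom[OF interp_homs(3)[of xs] lro_homs(1)]
  have "rint (xs @ [w]) (map (\<lambda>v. v) T) = rint xs T \<odot> \<pi>\<^sub>1 (cx xs) U"
  proof (rule rinterp_map)
    show "sint (xs @ [w]) t = sint xs t \<odot> \<pi>\<^sub>1 (cx xs) U" if "t \<in> set T" for t
      using assms that p by (intro sinterp_comp) (auto simp: fvs_def)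
  qed (use p plus_comp zero_comp[OF lro_homs(1)] in auto)
  then show ?thesis by simp
qed

section \<open>Differential substitution as a derivative\<close>

text \<open>The direction in \<open>\<star>\<close> moves only the last coordinate, and a binder
  appends a further one after \<open>y\<close>; hence the induction carries a general
  \<open>d\<close>.\<close>

lemma rinterp_dsub:
  assumes "d \<in> hom C (cx xs) (cx xs)"
    and "\<And>v. proj C U xs v \<odot> d = (if v = y then rint xs T else \<zero> (cx xs) U)"
  shows "rint xs (dsub y T s) = \<D> (sint xs s) \<odot> \<langle>d, \<I> (cx xs)\<rangle>"
  using assms
proof (induction y T s arbitrary: xs d rule: dsub.induct)
  case (1 y T z)
  have "\<D> (proj C U xs z) \<odot> \<langle>d, \<I> (cx xs)\<rangle> = proj C U xs z \<odot> d"
    using proj_linear[OF lro_homs(1), of xs z] proj_hom[OF lro_homs(1), of xs z] 1(1) interp_homs(3)[of xs]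
    by (simp add: linear_def hom_def cat_simps)
  then show ?case using 1(2)[of z] by (auto simp: rinterp_def)
next
  case (2 y T s V)
  note d = 2(3)
  let ?D = "\<lambda>f. \<D> f \<odot> \<langle>d, \<I> (cx xs)\<rangle>"
  note hs = interp_homs(1)[of xs s] and hV = interp_homs(2)[of xs V]
  note I = Id_hom[OF interp_homs(3)[of xs]] and dI = Pair_hom[OF d Id_hom[OF interp_homs(3)[of xs]]]
  have s: "rint xs (dsub y T s) = ?D (sint xs s)" using 2 by blast
  \<comment> \<open>By D1 the derivative along \<open>d\<close> is additive, so it commutes with the
    sum of the arguments.\<close>
  have V: "rint xs (concat (map (dsub y T) V)) = ?D (rint xs V)"
  proof (rule rinterp_concat_map)
    show "?D (f \<oplus> g) = ?D f \<oplus> ?D g" if "f \<in> hom C (cx xs) U" "g \<in> hom C (cx xs) U" for f g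
      using D1_plus[OF that] plus_comp[OF D_hom[OF that(1)] D_hom[OF that(2)] dI] by simp
    show "?D (\<zero> (cx xs) U) = \<zero> (cx xs) U"
      using D1_zero[OF interp_homs(3) lro_homs(1)] zero_comp[OF lro_homs(1) dI] by simp
  qed (use 2 in blast)
  have dV: "?D (rint xs V) \<in> hom C (cx xs) U" using comp_hom[OF D_hom[OF hV] dI] .
  let ?f = "\<Lambda>\<^sup>- U U (\<A> \<odot> sint xs s) \<star> ?D (rint xs V)"
  have f: "?f \<in> hom C (cx xs \<otimes> U) U" by (rule star_hom[OF uncur_app_hom[OF hs] dV])
  note c = Cur_hom[OF interp_homs(3)[of xs] lro_homs(1) f]
  \<comment> \<open>Since \<open>\<A> \<odot> lam\<close> is the identity, applying this abstraction
    is a beta step that evaluates \<open>?f\<close> at the old argument.\<close>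
  have "app_hom (lam \<odot> \<Lambda> (cx xs) U ?f) (rint xs V) =
      ev U U \<odot> \<langle>\<Lambda> (cx xs) U ?f \<odot> \<I> (cx xs), rint xs V\<rangle>"
    unfolding app_hom_def using comp_assoc[OF lro_homs(2,3) c] lro_homs(4) Id_comp[OF c] comp_Id[OF c]
    by simp
  also have "\<dots> = ?f \<odot> \<langle>\<I> (cx xs), rint xs V\<rangle>" by (rule Ev_Cur_Pair[OF f I hV])
  finally have "rint xs (dsub y T (RApp s V)) =
      app_hom (?D (sint xs s)) (rint xs V) \<oplus> ?f \<odot> \<langle>\<I> (cx xs), rint xs V\<rangle>"
    by (simp add: rinterp_append rinterp_sum_app rinterp_sum_dif rinterp_single s V dif_hom_def)
  also have "\<dots> = ?D (sint xs (RApp s V))"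
    unfolding sinterp_app_dif app_hom_def
    using D_Ev_Pair_along[OF comp_hom[OF lro_homs(2) hs] hV d lro_homs(1)]
      linear_D_comp_along[OF lro_linear(1) lro_homs(2) hs d] by simp
  finally show ?case .
next
  case (3 y T z s)
  note d = 3(2)
  define w where "w = fresh ({y} \<union> fvs T \<union> names s)"
  have w: "w \<noteq> y" "w \<notin> fvs T" "w \<notin> names s"
    using fresh[of "{y} \<union> fvs T \<union> names s"] unfolding w_def by auto
  let ?X = "cx xs" and ?s = "ren (id(z := w)) s"
  let ?d = "\<langle>d \<odot> \<pi>\<^sub>1 ?X U, \<zero> (?X \<otimes> U) U\<rangle>"
  note hs = interp_homs(1)[of "xs @ [w]" ?s, simplified]
  have "rint (xs @ [w]) (dsub y T ?s) = \<D> (sint (xs @ [w]) ?s) \<odot> \<langle>?d, \<I> (cx (xs @ [w]))\<rangle>"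
  proof (rule 3(1)[OF w_def])
    show "?d \<in> hom C (cx (xs @ [w])) (cx (xs @ [w]))"
      using d interp_homs(3)[of xs] lro_homs(1) by (simp add: hom_def cat_simps)
    fix v
    have "proj C U xs v \<odot> (d \<odot> \<pi>\<^sub>1 ?X U) = (proj C U xs v \<odot> d) \<odot> \<pi>\<^sub>1 ?X U"
      using comp_assoc[OF proj_hom[OF lro_homs(1)] d Pi1_hom[OF interp_homs(3) lro_homs(1)]] by simp
    \<comment> \<open>For \<open>v = w\<close> the component is zero, in agreement with
      \<open>w \<noteq> y\<close>. For other names the old condition is composed with
      \<open>\<pi>\<^sub>1\<close>, which weakens \<open>T\<close> because \<open>w\<close> is not
      free in it.\<close>
    then show "proj C U (xs @ [w]) v \<odot> ?d =
        (if v = y then rint (xs @ [w]) T else \<zero> (cx (xs @ [w])) U)"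
      using d w 3(3)[of v] interp_homs(3)[of xs] lro_homs(1) proj_hom[of U xs v]
      by (auto simp: hom_def cat_simps rinterp_weaken)
  qed
  then have "rint xs (dsub y T (RLam z s)) =
      lam \<odot> \<Lambda> ?X U (\<D> (sint (xs @ [w]) ?s) \<odot> \<langle>?d, \<I> (?X \<otimes> U)\<rangle>)"
    by (simp add: Let_def rinterp_sum_lam w_def)
  also have "\<dots> = \<D> (sint xs (RLam w ?s)) \<odot> \<langle>d, \<I> ?X\<rangle>"
    using D_Cur_along[OF hs d lro_homs(1)]
      linear_D_comp_along[OF lro_linear(2) lro_homs(3) Cur_hom[OF interp_homs(3) lro_homs(1) hs] d] by simp
  also have "sint xs (RLam w ?s) = sint xs (RLam z s)"
    using sinterp_respects[OF lro s_alpha[OF w(3)]] by metis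
  finally show ?case .
next
  case (4 y T s u)
  note d = 4(3)
  let ?X = "cx xs"
  let ?D = "\<lambda>f. \<D> f \<odot> \<langle>d, \<I> ?X\<rangle>"
  let ?f = "\<Lambda>\<^sup>- U U (\<A> \<odot> sint xs s)" and ?u = "sint xs u"
  note hs = interp_homs(1)[of xs s] and hu = interp_homs(1)[of xs u]
  note dI = Pair_hom[OF d Id_hom[OF interp_homs(3)[of xs]]]
  note ds = comp_hom[OF D_hom[OF hs] dI] and du = comp_hom[OF D_hom[OF hu] dI]
  note f = uncur_app_hom[OF hs]
  note fu = star_hom[OF f hu]
  have s: "rint xs (dsub y T s) = ?D (sint xs s)" and u: "rint xs (dsub y T u) = ?D ?u"
    using 4 by blast+
  \<comment> \<open>The derivative passes through \<open>lam\<close> and currying, the Leibniz rule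
    splits it, and in the first summand it passes on through uncurrying and
    \<open>\<A>\<close>.\<close>
  have "?D (sint xs (RDif s u)) = lam \<odot> \<Lambda> ?X U
      (\<Lambda>\<^sup>- U U (\<A> \<odot> ?D (sint xs s)) \<star> ?u \<oplus> ?f \<star> ?D ?u)"
    unfolding sinterp_app_dif dif_hom_def
    using linear_D_comp_along[OF lro_linear(2) lro_homs(3) Cur_hom[OF interp_homs(3) lro_homs(1) fu] d]
      D_Cur_along[OF fu d lro_homs(1)] D_star_along[OF f hu d]
      D_uncur_along[OF comp_hom[OF lro_homs(2) hs] d lro_homs(1,1)]
      linear_D_comp_along[OF lro_linear(1) lro_homs(2) hs d] by simp
  also have "\<dots> = dif_hom ?X (?D (sint xs s)) ?u \<oplus> dif_hom ?X (sint xs s) (?D ?u)"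
    unfolding dif_hom_def
    using lam_Cur_plus[OF star_hom[OF uncur_app_hom[OF ds] hu] star_hom[OF f du] interp_homs(3)] .
  also have "\<dots> = rint xs (dsub y T (RDif s u))"
    by (simp add: rinterp_append rinterp_sum_dif rinterp_single s u)
  finally show ?case ..
qed

lemma rinterp_dsubs:
  assumes "y \<notin> fvs T"
  shows "rint (xs @ [y]) (dsubs y T S) = rint (xs @ [y]) S \<star> rint xs T"
proof -
  let ?X = "cx xs" and ?T = "rint xs T"
  \<comment> \<open>This is the direction in the definition of \<open>\<star>\<close>. Its last
    component is \<open>T\<close> weakened by \<open>y\<close>, which is where \<open>y\<close> not
    being free in \<open>T\<close> enters.\<close>
  let ?d = "\<langle>\<zero> (?X \<otimes> U) ?X, ?T \<odot> \<pi>\<^sub>1 ?X U\<rangle>"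
  note hT = interp_homs(2)[of xs T]
  have d: "?d \<in> hom C (cx (xs @ [y])) (cx (xs @ [y]))"
    using hT interp_homs(3)[of xs] lro_homs(1) by (simp add: hom_def cat_simps)
  have p: "proj C U (xs @ [y]) v \<odot> ?d = (if v = y then rint (xs @ [y]) T else \<zero> (cx (xs @ [y])) U)" for v
    using hT interp_homs(3)[of xs] lro_homs(1) proj_hom[of U xs v]
      linear_comp_zero[OF proj_linear[OF lro_homs(1), of xs v] proj_hom[OF lro_homs(1)], of "?X \<otimes> U"]
    by (auto simp: hom_def cat_simps rinterp_weaken[OF assms])
  have "rint (xs @ [y]) (dsub y T s) = sint (xs @ [y]) s \<star> ?T" for s
    using rinterp_dsub[OF d p] star_eq[OF hT] by simp
  then show ?thesis unfolding dsubs_def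
    using star_plus_left[OF _ _ hT] star_zero_left[OF hT lro_homs(1)]
    by (intro rinterp_concat_map[where \<phi> = "\<lambda>f. f \<star> ?T"]) auto
qed

end

end

theorem theorem4p10:
  fixes C :: "('o, 'm) ccd_cat" and U :: 'o and \<A> lam :: 'm
    and S T :: dterm and xs :: "var list" and y :: var
  assumes "cartesian_closed_differential_category C"
    and "linear_reflexive_object C U \<A> lam"
    and "distinct xs" and "y \<notin> set xs"
    and "adequate (xs @ [y]) S" and "adequate xs T"
  shows "interp C U \<A> lam (xs @ [y]) (dsubst y T S) =
         interp C U \<A> lam (xs @ [y]) S \<star>\<^bsub>C\<^esub> interp C U \<A> lam xs T"
proof -
  interpret cartesian_closed_differential_category C by fact
  have "y \<notin> fvs (rep_dterm T)" using assms(4,6) by (auto simp: adequate_def FV.rep_eq)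
  from rinterp_dsubs[OF assms(2) this, of xs "rep_dterm S"]
  have "rinterp C U \<A> lam (xs @ [y]) (dsubs y (rep_dterm T) (rep_dterm S)) =
      interp C U \<A> lam (xs @ [y]) S \<star>\<^bsub>C\<^esub> interp C U \<A> lam xs T"
    by (simp add: interp_def)
  moreover have "dsubst y T S = abs_dterm (dsubs y (rep_dterm T) (rep_dterm S))"
    by (metis Quotient3_abs_rep[OF Quotient3_dterm] dsubst.abs_eq)
  ultimately show ?thesis using interp_abs[OF assms(2)] by simp
qed

end
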